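(* Let $\mathcal{D}$ be a checkerboard shaded link diagram, all of whose regions are contractible, in a torus $S$, and let $G$ and $G^*$ be its two Tait graphs (arising from the two checkerboard shadings of $\mathcal{D}$). Then the Laplacian polynomials of $G$ and $G^*$ are equal: $\Delta_G = \Delta_{G^*}$ (up to multiplication by units of $\Lambda=\mathbb{Z}[x^{\pm1},y^{\pm1}]$, module orders being defined only up to units).
   Context: Let $S$ be a torus and fix oriented simple loops $x,y$ in $S$, meeting only at one common point, such that cutting $S$ along them yields a polygon ($4$-gon) with sides identified in the usual way. Write $H_1(S;\mathbb{Z})\cong\mathbb{Z}^2$ multiplicatively as the free abelian group generated by $x,y$, and let $\Lambda=\mathbb{Z}[H_1(S;\mathbb{Z})]=\mathbb{Z}[x^{\pm1},y^{\pm1}]$. Let $\tilde S\to S$ be the universal abelian cover, with deck transformation group identified with $H_1(S;\mathbb{Z})$. A link diagram $\mathcal{D}$ in $S$ represents a link in the thickened surface $S\times[0,1]$: it is a $4$-valent graph embedded in $S$ (the universe) with over/under crossing information at each vertex. The regions of $\mathcal{D}$ are the components of the complement in $S$ of the universe. A checkerboard shading of $\mathcal{D}$ is a shading of some of the regions such that whenever two regions share a common arc, exactly one of them is shaded; if one checkerboard shading exists, there are exactly two, and they are complementary. Tait graph: given a checkerboard shading, the Tait graph $G$ is the graph embedded in $S$ with one vertex in each shaded region and one edge through each crossing, joining the shaded regions that meet at that crossing (loops and multiple edges are allowed). Each edge $e$ carries a weight $w_e=\pm1$ determined by the crossing: fix an orientation of $S$; travelling along $e$ from one of its ends toward the crossing,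 $w_e=+1$ if, near the crossing, the shaded region one is leaving and the unshaded region on the left of $e$ lie on opposite sides of the overcrossing strand, and $w_e=-1$ otherwise (this does not depend on which end of $e$ one starts from). The other checkerboard shading gives the Tait graph $G^*$, which is dual to $G$; each edge $e^*$ of $G^*$ meets the corresponding edge $e$ of $G$ transversely in one point, and $w_ew_{e^*}=-1$. Laplacian matrix, module and polynomial: let $v_1,\dots,v_n$ be the vertices of $G$ and choose a lift $\tilde v_i\in\tilde S$ of each $v_i$. Define the $n\times n$ matrix $A=(a_{i,j})$ over $\Lambda$ by letting $a_{i,j}$ be the sum of $w_e\,h$ over all edges $e$ from $v_i$ to $v_j$, where $h\in H_1(S;\mathbb{Z})$ is the element such that the lift of $e$ to $\tilde S$ starting at $\tilde v_i$ ends at $h\tilde v_j$; an edge joining $v_i$ to itself is counted twice, once for each direction of travel, so that it contributes $w_e(h+h^{-1})$ to $a_{i,i}$. Let $\delta$ be the $n\times n$ diagonal matrix with $\delta_{i,i}$ the sum of the weights $w_e$ of edges incident to $v_i$, loops counted twice. The Laplacian matrix is $L_G=\delta-A$. The Laplacian module $\mathcal{L}_G$ is the cokernel of $L_G$, that is, the $\Lambda$-module with generators $v_1,\dots,v_n$ and relations given by the rows of $L_G$. The Laplacian polynomial $\Delta_G\in\Lambda$ is the module order of $\mathcal{L}_G$, which is computed as $\det L_G$; as a module order it is well defined up to multiplication by units $\pm x^ay^b$ ($a,b\in\mathbb{Z}$) of $\Lambda$. The polynomial $\Delta_{G^*}$ is defined in the same way from $G^*$. *)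

theory Defs
  imports
    "HOL-Library.Poly_Mapping"
    "HOL-Library.Product_Plus"
    "HOL-Combinatorics.Orbits"
    "HOL-Algebra.Coset"
    "HOL-Algebra.Elementary_Groups"
    "Graph_Theory.Digraph"
    "Jordan_Normal_Form.Determinant"
begin

section \<open>Link diagrams on a torus with contractible regions\<close>

text \<open>
  A link diagram in a closed oriented surface whose regions are all contractible is a cellularly
  embedded \<open>4\<close>-valent graph, and is encoded by its combinatorial map (rotation system).
  A dart is an edge of the universe together with a choice of one of its two ends, viewed as
  emanating from the crossing at that end; \<open>rot\<close> sends a dart to the next dart,
  counterclockwise, at the same crossing, and \<open>flip\<close> sends it to the dart at the other end of the
  same edge. \<open>over d\<close> says that \<open>d\<close> belongs to the overcrossing strand of its crossing.
\<close>

record 'd link_diagram =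
  darts :: "'d set"
  rot :: "'d \<Rightarrow> 'd"
  flip :: "'d \<Rightarrow> 'd"
  over :: "'d \<Rightarrow> bool"

definition crossings :: "'d link_diagram \<Rightarrow> 'd set set" where
  "crossings D = (\<lambda>d. orbit (rot D) d) ` darts D"

definition edges :: "'d link_diagram \<Rightarrow> 'd set set" where
  "edges D = (\<lambda>d. {d, flip D d}) ` darts D"

text \<open>
  A dart \<open>d\<close> also stands for the corner (sector at a crossing) between \<open>d\<close> and \<open>rot D d\<close>, which
  lies to the left of \<open>d\<close>. Walking around a region from the corner \<open>d\<close>, along the edge of
  \<open>rot D d\<close>, the next corner met is \<open>flip D (rot D d)\<close>. A region is thus given by the set of its
  corners, and \<open>region D d\<close> is the region on the left of \<open>d\<close>; the region on the right of \<open>d\<close> is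
  \<open>region D (flip D d)\<close>.
\<close>

definition region :: "'d link_diagram \<Rightarrow> 'd \<Rightarrow> 'd set" where
  "region D d = orbit (\<lambda>d. flip D (rot D d)) d"

definition regions :: "'d link_diagram \<Rightarrow> 'd set set" where
  "regions D = region D ` darts D"

text \<open>
  The surface is recovered by gluing one disc to the universe for every region; it is connected
  iff the universe is, and it is then a torus iff its Euler characteristic vanishes.
\<close>

definition torus_link_diagram :: "'d link_diagram \<Rightarrow> bool" where
  "torus_link_diagram D \<longleftrightarrow>
     finite (darts D) \<and> darts D \<noteq> {} \<and>
     rot D permutes darts D \<and> (\<forall>d\<in>darts D. card (orbit (rot D) d) = 4) \<and>
     flip D permutes darts D \<and> (\<forall>d\<in>darts D. flip D d \<noteq> d \<and> flip D (flip D d) = d) \<and>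
     (\<forall>d\<in>darts D. over D (rot D d) \<longleftrightarrow> \<not> over D d) \<and>
     (\<forall>d\<in>darts D. \<forall>d'\<in>darts D. (d, d') \<in> {(a, b). b = rot D a \<or> b = flip D a}\<^sup>*) \<and>
     int (card (crossings D)) - int (card (edges D)) + int (card (regions D)) = 0"

definition checkerboard_shading :: "'d link_diagram \<Rightarrow> 'd set set \<Rightarrow> bool" where
  "checkerboard_shading D Sh \<longleftrightarrow>
     Sh \<subseteq> regions D \<and> (\<forall>d\<in>darts D. region D d \<in> Sh \<longleftrightarrow> region D (flip D d) \<notin> Sh)"


section \<open>The first homology group and the universal abelian cover\<close>

text \<open>
  Cellular homology of the surface. A chain is an integral combination \<open>k\<close> of oriented edges,
  the dart \<open>d\<close> being oriented away from its crossing. Both orientations of an edge are kept as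
  generators, so the boundaries are spanned by the boundary walks of the regions together with
  the chains \<open>d + flip D d\<close>.
\<close>

definition cycle_group :: "'d link_diagram \<Rightarrow> ('d \<Rightarrow> int) monoid" where
  "cycle_group D =
     \<lparr>carrier = {k. (\<forall>d. d \<notin> darts D \<longrightarrow> k d = 0) \<and>
                    (\<forall>v\<in>crossings D. (\<Sum>d\<in>v. k d - k (flip D d)) = 0)},
      mult = (\<lambda>k l d. k d + l d),
      one = (\<lambda>_. 0)\<rparr>"

definition boundaries :: "'d link_diagram \<Rightarrow> ('d \<Rightarrow> int) set" where
  "boundaries D =
     {k. (\<forall>d. d \<notin> darts D \<longrightarrow> k d = 0) \<and>
         (\<exists>(m :: 'd set \<Rightarrow> int) (n :: 'd set \<Rightarrow> int).
            \<forall>d\<in>darts D. k d = m (region D d) + n {d, flip D d})}"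

definition homology1 :: "'d link_diagram \<Rightarrow> ('d \<Rightarrow> int) set monoid" where
  "homology1 D = cycle_group D Mod boundaries D"

text \<open>
  The choice of the loops \<open>x, y\<close> enters through the isomorphism it determines from the first
  homology group to \<open>\<int> \<times> \<int>\<close>, with \<open>x \<mapsto> (1, 0)\<close> and \<open>y \<mapsto> (0, 1)\<close>. Every basis
  of the first homology group of a torus is represented by such a pair of loops.
\<close>

definition homology_marking ::
    "'d link_diagram \<Rightarrow> (('d \<Rightarrow> int) set \<Rightarrow> int \<times> int) \<Rightarrow> bool" where
  "homology_marking D \<mu> \<longleftrightarrow> \<mu> \<in> iso (homology1 D) (integer_group \<times>\<times> integer_group)"

text \<open>
  A voltage assignment for \<open>\<mu>\<close> gives every oriented edge a value in \<open>\<int> \<times> \<int>\<close> such that the total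
  value of a cycle is the image under \<open>\<mu>\<close> of its homology class. As \<open>d + flip D d\<close> is a boundary,
  \<open>c (flip D d) = - c d\<close> follows. Choosing \<open>c\<close> amounts to choosing base points in the fibres of
  the universal abelian cover over the crossings.
\<close>

definition voltage ::
    "'d link_diagram \<Rightarrow> (('d \<Rightarrow> int) set \<Rightarrow> int \<times> int) \<Rightarrow> ('d \<Rightarrow> int \<times> int) \<Rightarrow> bool" where
  "voltage D \<mu> c \<longleftrightarrow>
     (\<forall>k\<in>carrier (cycle_group D).
        \<mu> (boundaries D #>\<^bsub>cycle_group D\<^esub> k)
          = ((\<Sum>d\<in>darts D. k d * fst (c d)), (\<Sum>d\<in>darts D. k d * snd (c d))))"

text \<open>
  The preimage of the diagram in the universal abelian cover: the dart \<open>d\<close> at sheet \<open>g\<close> leads to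
  its other end at sheet \<open>g + c d\<close>. The deck transformation \<open>h\<close> translates sheets by \<open>h\<close>.
\<close>

definition abelian_cover ::
    "'d link_diagram \<Rightarrow> ('d \<Rightarrow> int \<times> int) \<Rightarrow> ('d \<times> (int \<times> int)) link_diagram" where
  "abelian_cover D c =
     \<lparr>darts = darts D \<times> UNIV,
      rot = (\<lambda>(d, g). (rot D d, g)),
      flip = (\<lambda>(d, g). (flip D d, g + c d)),
      over = (\<lambda>(d, g). over D d)\<rparr>"

definition deck :: "int \<times> int \<Rightarrow> 'd \<times> (int \<times> int) \<Rightarrow> 'd \<times> (int \<times> int)" where
  "deck h = (\<lambda>(d, g). (d, h + g))"

definition lifted_shading ::
    "'d link_diagram \<Rightarrow> ('d \<Rightarrow> int \<times> int) \<Rightarrow> 'd set set \<Rightarrow> ('d \<times> (int \<times> int)) set set" where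
  "lifted_shading D c Sh = {R \<in> regions (abelian_cover D c). fst ` R \<in> Sh}"


section \<open>Tait graphs\<close>

text \<open>
  An undirected graph is represented by the digraph having one arc for each direction of travel
  along each edge. For the Tait graph, the arc \<open>d\<close> starts in the shaded region having the corner
  \<open>d\<close>, passes through the crossing and ends in the region having the opposite corner
  \<open>rot D (rot D d)\<close>; the reverse arc is \<open>rot D (rot D d)\<close>. A loop contributes two arcs.

  Entering the crossing from the corner \<open>d\<close>, the corner on the left is the one between the
  predecessor of \<open>d\<close> under \<open>rot D\<close> and \<open>d\<close>. Among the two strands at the crossing, it is separated
  from the corner \<open>d\<close> by the strand through \<open>d\<close> only; so the weight is \<open>1\<close> iff that strand is
  the overcrossing one.
\<close>

record ('a, 'b) weighted_graph = "('a, 'b) pre_digraph" +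
  weight :: "'b \<Rightarrow> int"

definition tait_graph :: "'d link_diagram \<Rightarrow> 'd set set \<Rightarrow> ('d set, 'd) weighted_graph" where
  "tait_graph D Sh =
     \<lparr>verts = Sh,
      arcs = {d \<in> darts D. region D d \<in> Sh},
      tail = region D,
      head = (\<lambda>d. region D (rot D (rot D d))),
      weight = (\<lambda>d. if over D d then 1 else -1)\<rparr>"


section \<open>Laplacian matrix and Laplacian polynomial\<close>

text \<open>The group ring of \<open>\<int> \<times> \<int>\<close>; \<open>Poly_Mapping.single (a, b) 1\<close> is the monomial
  \<open>x\<^sup>a y\<^sup>b\<close>.\<close>

type_synonym laurent = "(int \<times> int) \<Rightarrow>\<^sub>0 int"

text \<open>\<open>vs\<close> lists one lift to the universal abelian cover for each vertex of the Tait graph.\<close>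

definition lifted_vertices ::
    "'d link_diagram \<Rightarrow> ('d \<Rightarrow> int \<times> int) \<Rightarrow> 'd set set \<Rightarrow> ('d \<times> (int \<times> int)) set list \<Rightarrow> bool"
  where
  "lifted_vertices D c Sh vs \<longleftrightarrow>
     set vs \<subseteq> verts (tait_graph (abelian_cover D c) (lifted_shading D c Sh)) \<and>
     distinct (map (image fst) vs) \<and>
     set (map (image fst) vs) = verts (tait_graph D Sh)"

text \<open>
  The arcs of the Tait graph starting at the \<open>i\<close>-th vertex correspond to the arcs \<open>e\<close> of its
  preimage in the cover starting at the lift \<open>vs ! i\<close>, and \<open>h\<close> is determined by \<open>e\<close> and \<open>j\<close>.
\<close>

definition adjacency_entry ::
    "'d link_diagram \<Rightarrow> ('d \<Rightarrow> int \<times> int) \<Rightarrow> 'd set set \<Rightarrow> ('d \<times> (int \<times> int)) set list \<Rightarrow>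
     nat \<Rightarrow> nat \<Rightarrow> laurent" where
  "adjacency_entry D c Sh vs i j =
     (let G = tait_graph (abelian_cover D c) (lifted_shading D c Sh) in
      \<Sum>(e, h)\<in>{(e, h). e \<in> arcs G \<and> tail G e = vs ! i \<and> head G e = deck h ` (vs ! j)}.
        Poly_Mapping.single h (weight G e))"

definition degree_entry ::
    "'d link_diagram \<Rightarrow> 'd set set \<Rightarrow> ('d \<times> (int \<times> int)) set list \<Rightarrow> nat \<Rightarrow> laurent" where
  "degree_entry D Sh vs i =
     (let G = tait_graph D Sh in
      \<Sum>e\<in>{e \<in> arcs G. tail G e = fst ` (vs ! i)}. of_int (weight G e))"

definition laplacian_matrix ::
    "'d link_diagram \<Rightarrow> ('d \<Rightarrow> int \<times> int) \<Rightarrow> 'd set set \<Rightarrow> ('d \<times> (int \<times> int)) set list \<Rightarrow>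
     laurent mat" where
  "laplacian_matrix D c Sh vs =
     mat (length vs) (length vs)
       (\<lambda>(i, j). (if i = j then degree_entry D Sh vs i else 0) - adjacency_entry D c Sh vs i j)"

text \<open>
  A matrix \<open>P\<close> presents the module with one generator for each column and one relation for each
  row. Its order is a greatest common divisor of the minors of \<open>P\<close> of size the number of
  generators (the generators of the zeroth elementary ideal), and is defined up to units.
\<close>

definition maximal_minors :: "'a::comm_ring_1 mat \<Rightarrow> 'a set" where
  "maximal_minors P =
     {det (mat (dim_col P) (dim_col P) (\<lambda>(i, j). P $$ (f i, j))) |f.
        f \<in> {..<dim_col P} \<rightarrow> {..<dim_row P}}"

definition module_order :: "'a::comm_ring_1 mat \<Rightarrow> 'a \<Rightarrow> bool" where
  "module_order P \<Delta> \<longleftrightarrow>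
     (\<forall>m\<in>maximal_minors P. \<Delta> dvd m) \<and>
     (\<forall>b. (\<forall>m\<in>maximal_minors P. b dvd m) \<longrightarrow> b dvd \<Delta>)"

lemma module_order_det:
  fixes P :: "'a::comm_ring_1 mat"
  assumes P: "P \<in> carrier_mat n n"
  shows "module_order P (det P)"
proof -
  have dims: "dim_row P = n" "dim_col P = n" using P by auto
  have "det P \<in> maximal_minors P"
    unfolding maximal_minors_def dims
    by (rule CollectI, rule exI[of _ id]) (auto intro!: arg_cong[of _ _ det] simp: dims)
  moreover have "det P dvd m" if "m \<in> maximal_minors P" for m
  proof -
    from that obtain f where f: "f \<in> {..<n} \<rightarrow> {..<n}"
      and m: "m = det (mat n n (\<lambda>(i, j). P $$ (f i, j)))"
      unfolding maximal_minors_def dims by auto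
    show ?thesis
    proof (cases "inj_on f {..<n}")
      case True
      define p where "p i = (if i < n then f i else i)" for i
      have "f ` {..<n} = {..<n}"
        using True f by (intro endo_inj_surj) auto
      then have "bij_betw p {0..<n} {0..<n}"
        using True by (auto simp: bij_betw_def p_def inj_on_def image_def lessThan_atLeast0)
      then have p: "p permutes {0..<n}"
        by (rule bij_imp_permutes) (auto simp: p_def)
      have "m = det (mat n n (\<lambda>(i, j). P $$ (p i, j)))"
        unfolding m by (intro arg_cong[of _ _ det] eq_matI) (auto simp: p_def)
      then show ?thesis using det_permute_rows[OF P p] by simp
    next
      case False
      then obtain i j where ij: "i < n" "j < n" "i \<noteq> j" "f i = f j"
        by (auto simp: inj_on_def)
      have "m = 0" unfolding m
        by (rule det_identical_rows[OF _ ij(3,1,2)]) (use ij in \<open>auto intro!: eq_vecI\<close>)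
      then show ?thesis by simp
    qed
  qed
  ultimately show ?thesis by (auto simp: module_order_def)
qed

definition laplacian_polynomial ::
    "'d link_diagram \<Rightarrow> ('d \<Rightarrow> int \<times> int) \<Rightarrow> 'd set set \<Rightarrow> ('d \<times> (int \<times> int)) set list \<Rightarrow>
     laurent \<Rightarrow> bool" where
  "laplacian_polynomial D c Sh vs \<Delta> \<longleftrightarrow> module_order (laplacian_matrix D c Sh vs) \<Delta>"

corollary laplacian_polynomial_det:
  "laplacian_polynomial D c Sh vs (det (laplacian_matrix D c Sh vs))"
  unfolding laplacian_polynomial_def
  by (rule module_order_det[where n = "length vs"]) (simp add: laplacian_matrix_def)

end

theory Submission
  imports Defs "HOL-Library.Product_Lexorder"
begin

text \<open>
  Let the bar denote the involution of the Laurent polynomial ring \<open>\<Lambda>\<close>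
  inverting \<open>x\<close> and \<open>y\<close>, and let \<open>bar P\<close> and
  \<open>bar Q\<close> be the boundary matrices over \<open>\<Lambda>\<close> of the preimages of
  \<open>G\<close> and \<open>G\<^sup>*\<close> in the universal abelian cover. Their rows are
  indexed by the shaded and by the unshaded regions, their columns both by the crossings, an edge of
  \<open>G\<close> and its dual edge having the same column. Let \<open>W\<close> be the diagonal
  matrix of the weights, so that \<open>W W = 1\<close>. Then
  \<open>L\<^sub>G = P W bar P\<^sup>T\<close>, while
  \<open>L\<^bsub>G*\<^esub> = - Q W bar Q\<^sup>T\<close> because dual edges have opposite weights.

  Three facts of topology enter. The boundary of a face of \<open>G\<close> is a cycle:
  \<open>P bar Q\<^sup>T = 0\<close>. As the Euler characteristic of the torus is zero, there are as
  many crossings as regions, so that \<open>P\<close> stacked upon \<open>Q W\<close> is a square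
  matrix; let \<open>m\<close> be its determinant. Finally both preimages are connected, so that any
  vertex and its translate under \<open>h\<close> are homologous, which says that
  \<open>P X = (h - 1) 1\<close> and \<open>Q Y = (h - 1) 1\<close> have solutions for every
  \<open>h\<close> in the homology group.

  Multiplying the stacked matrix by suitable square matrices gives block triangular products. With
  blocks \<open>X\<close> and \<open>bar Q\<^sup>T\<close> one sees that \<open>m\<close> divides
  \<open>(h - 1)\<^sup>p det (Q W bar Q\<^sup>T)\<close>; taking \<open>h = x\<close> and
  \<open>h = y\<close>, and using that \<open>x - 1\<close> and \<open>y - 1\<close> are coprime,
  \<open>m\<close> divides the determinant itself. Likewise \<open>m\<close> divides
  \<open>det (P W bar P\<^sup>T)\<close>. With blocks \<open>W bar P\<^sup>T\<close> and
  \<open>bar Q\<^sup>T\<close> one sees that the product of the two determinants is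
  \<open>m bar m\<close> up to sign. If \<open>m = 0\<close>, both determinants vanish. If
  \<open>m \<noteq> 0\<close> and \<open>s\<close>, \<open>t\<close> are the cofactors, then
  \<open>m s t = bar m\<close> up to sign, and applying the bar once more shows that
  \<open>s t bar (s t) = 1\<close>. Hence \<open>s\<close> and \<open>t\<close> are units and both
  Laplacian polynomials are associated to \<open>m\<close>. This is
  \<open>complementary_gram_dets_associated\<close>; the topological facts are
  \<open>incidence_orthogonal\<close>, \<open>card_regions\<close> and
  \<open>incidence_right_inverse\<close>, and the factorization of the Laplacian matrix is
  \<open>laplacian_eq_gram\<close>.
\<close>

section \<open>The Laurent polynomial ring\<close>

text \<open>
  A translation invariant linear order on the exponents makes the Laurent polynomial ring an
  integral domain, since leading terms multiply.
\<close>

instance prod :: ("{linorder, ordered_ab_group_add}", "{linorder, ordered_ab_group_add}")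
  ordered_cancel_comm_monoid_add
  by standard (auto simp: less_eq_prod_def)

abbreviation monomial :: "int \<times> int \<Rightarrow> laurent" where
  "monomial h \<equiv> Poly_Mapping.single h 1"

lemma monomial_mult: "monomial h * monomial k = monomial (h + k)"
  by (simp add: mult_single)

lemma monomial_eq_one_iff: "monomial h = 1 \<longleftrightarrow> h = 0"
  by (metis keys_single single_one singleton_inject zero_neq_one)

text \<open>
  The map of group rings induced by a map of exponents. It is used for the involution inverting
  \<open>x\<close> and \<open>y\<close> and for the substitution \<open>y = 1\<close>.
\<close>

definition reindex :: "(int \<times> int \<Rightarrow> int \<times> int) \<Rightarrow> laurent \<Rightarrow> laurent" where
  "reindex \<theta> = frag_extend (\<lambda>h. monomial (\<theta> h))"

lemma reindex_monomial [simp]: "reindex \<theta> (monomial h) = monomial (\<theta> h)"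
  by (simp add: reindex_def)

lemma reindex_diff: "reindex \<theta> (f - g) = reindex \<theta> f - reindex \<theta> g"
  by (simp add: reindex_def frag_extend_diff)

lemma reindex_zero: "reindex \<theta> 0 = 0"
  by (simp add: reindex_def)

lemma laurent_induct [case_names zero monomial diff]:
  assumes "Q 0" "\<And>h. Q (monomial h)" "\<And>f g. Q f \<Longrightarrow> Q g \<Longrightarrow> Q (f - g)"
  shows "Q (f :: laurent)"
  by (rule frag_induction[of f UNIV]) (use assms in auto)

lemma comm_ring_hom_reindex:
  assumes \<theta>: "\<And>h k. \<theta> (h + k) = \<theta> h + \<theta> k"
  shows "comm_ring_hom (reindex \<theta>)"
proof
  have "\<theta> 0 = 0" using \<theta>[of 0 0] by simp
  then show "reindex \<theta> 1 = 1" using reindex_monomial[of \<theta> 0] by simp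
  show "reindex \<theta> 0 = 0" by (rule reindex_zero)
  show "reindex \<theta> (f + g) = reindex \<theta> f + reindex \<theta> g" for f g
    by (simp add: reindex_def frag_extend_add)
  show "reindex \<theta> (f * g) = reindex \<theta> f * reindex \<theta> g" for f g
  proof (induction f rule: laurent_induct)
    case (monomial h)
    show ?case
      by (induction g rule: laurent_induct)
        (simp_all add: reindex_zero monomial_mult \<theta> reindex_diff right_diff_distrib)
  qed (simp_all add: reindex_zero reindex_diff left_diff_distrib)
qed

definition laurent_conj :: "laurent \<Rightarrow> laurent" where "laurent_conj = reindex uminus"

lemma laurent_conj_monomial [simp]: "laurent_conj (monomial h) = monomial (- h)"
  by (simp add: laurent_conj_def)

lemma comm_ring_hom_laurent_conj: "comm_ring_hom laurent_conj"
  unfolding laurent_conj_def by (rule comm_ring_hom_reindex) simp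

lemma laurent_conj_laurent_conj [simp]: "laurent_conj (laurent_conj f) = f"
  by (induction f rule: laurent_induct)
    (simp_all add: reindex_zero reindex_diff laurent_conj_def)

lemma y_minus_1_dvd: "monomial (0, 1) - 1 dvd monomial (0, b) - 1"
proof -
  have nat: "monomial (0, 1) - 1 dvd monomial (0, int n) - 1" for n
  proof (induction n)
    case 0
    then show ?case by (simp flip: zero_prod_def)
  next
    case (Suc n)
    have "monomial (0, int (Suc n)) - 1
        = monomial (0, 1) * (monomial (0, int n) - 1) + (monomial (0, 1) - 1)"
      by (simp add: right_diff_distrib monomial_mult)
    with Suc show ?case by (metis dvd_add dvd_mult dvd_refl)
  qed
  show ?thesis
  proof (cases b rule: int_cases2)
    case (nonneg n)
    with nat show ?thesis by simp
  next
    case (nonpos n)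
    have "monomial (0, b) - 1 = - monomial (0, b) * (monomial (0, int n) - 1)"
      by (simp add: algebra_simps monomial_mult nonpos flip: zero_prod_def)
    with nat[of n] show ?thesis by (metis dvd_mult)
  qed
qed

text \<open>
  Modulo \<open>y - 1\<close> every monomial \<open>x\<^sup>a y\<^sup>b\<close> equals
  \<open>x\<^sup>a\<close>. Hence the kernel of the substitution \<open>y = 1\<close> is the ideal
  generated by \<open>y - 1\<close>.
\<close>

lemma y_minus_1_dvd_diff: "monomial (0, 1) - 1 dvd f - reindex (\<lambda>h. (fst h, 0)) f"
proof (induction f rule: laurent_induct)
  case (monomial h)
  have "monomial h - monomial (fst h, 0) = monomial (fst h, 0) * (monomial (0, snd h) - 1)"
    by (simp add: right_diff_distrib monomial_mult)
  then show ?case by (simp add: y_minus_1_dvd)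
next
  case (diff f g)
  have "f - g - reindex (\<lambda>h. (fst h, 0)) (f - g)
      = (f - reindex (\<lambda>h. (fst h, 0)) f) - (g - reindex (\<lambda>h. (fst h, 0)) g)"
    by (simp add: reindex_diff)
  with diff show ?case by (metis dvd_diff)
qed (simp add: reindex_zero)

text \<open>
  The elements \<open>x - 1\<close> and \<open>y - 1\<close> are coprime: substituting
  \<open>y = 1\<close> kills multiples of \<open>y - 1\<close> but leaves \<open>x - 1\<close>
  unchanged, and so one factor \<open>y - 1\<close> after the other can be split off.
\<close>

lemma y_minus_1_cancel_x_minus_1:
  assumes "(monomial (0, 1) - 1) ^ N dvd f * (monomial (1, 0) - 1) ^ M"
  shows "(monomial (0, 1) - 1) ^ N dvd f"
  using assms
proof (induction N arbitrary: f)
  case (Suc N)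
  let ?x = "monomial (1, 0) - 1 :: laurent" and ?y = "monomial (0, 1) - 1 :: laurent"
  let ?r = "reindex (\<lambda>h. (fst h, 0))"
  interpret r: comm_ring_hom ?r by (rule comm_ring_hom_reindex) simp
  have x: "?x \<noteq> 0" and y: "?y \<noteq> 0"
    using monomial_eq_one_iff[of "(1, 0)"] monomial_eq_one_iff[of "(0, 1)"] by (auto simp: zero_prod_def)
  from Suc.prems obtain g where g: "f * ?x ^ M = ?y ^ Suc N * g" by (elim dvdE)
  have r1: "?r (monomial (0,0)) = monomial (0,0)" by simp
  have "?r ?y = 0" "?r ?x = ?x" using r1 by (simp_all add: r.hom_minus flip: zero_prod_def)
  then have "?r f * ?x ^ M = 0"
    using arg_cong[OF g, of ?r] by (simp only: r.hom_mult r.hom_power power_Suc) simp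
  with x have "?r f = 0" by simp
  with y_minus_1_dvd_diff[of f] obtain f' where f': "f = ?y * f'" by (auto elim: dvdE)
  from g have "?y * (f' * ?x ^ M) = ?y * (?y ^ N * g)"
    unfolding f' by (simp only: power_Suc mult.assoc)
  with y have "f' * ?x ^ M = ?y ^ N * g" by (metis mult_left_cancel)
  then have "?y ^ N dvd f'" using Suc.IH[of f'] by simp
  then show ?case unfolding f' power_Suc by (rule mult_dvd_mono[OF dvd_refl])
qed simp


section \<open>Determinants of complementary Gram matrices\<close>

text \<open>
  Blocks are functions of the row and column index, so that their sums, products and images under
  a ring homomorphism need no side conditions on dimensions.
\<close>

definition stack :: "nat \<Rightarrow> nat \<Rightarrow> (nat \<Rightarrow> nat \<Rightarrow> 'a) \<Rightarrow> (nat \<Rightarrow> nat \<Rightarrow> 'a) \<Rightarrow> 'a mat" where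
  "stack p q A B = mat (p + q) (p + q) (\<lambda>(i, k). if i < p then A i k else B (i - p) k)"

text \<open>
  The matrix product \<open>A B\<^sup>T\<close> of two blocks having \<open>p\<close> rows and
  \<open>n\<close> columns.
\<close>

definition gram :: "nat \<Rightarrow> nat \<Rightarrow> (nat \<Rightarrow> nat \<Rightarrow> 'a) \<Rightarrow> (nat \<Rightarrow> nat \<Rightarrow> 'a) \<Rightarrow> 'a::comm_ring_1 mat" where
  "gram n p A B = mat p p (\<lambda>(i, j). \<Sum>k<n. A i k * B j k)"

lemma stack_carrier [simp]: "stack p q A B \<in> carrier_mat (p + q) (p + q)"
  by (simp add: stack_def)

lemma gram_transpose: "transpose_mat (gram n p A B) = gram n p B A"
  by (rule eq_matI) (simp_all add: gram_def mult.commute)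

lemma det_gram_commute: "det (gram n p A B) = det (gram n p B A)"
  using det_transpose[of "gram n p A B" p] by (simp add: gram_transpose) (simp add: gram_def)

text \<open>
  The product of one stack with the transpose of the other has the four blocks
  \<open>A C\<^sup>T\<close>, \<open>A E\<^sup>T\<close>, \<open>B C\<^sup>T\<close> and
  \<open>B E\<^sup>T\<close>; it is block triangular when \<open>A E\<^sup>T = 0\<close>.
\<close>

lemma det_stack_mult:
  fixes A B C E :: "nat \<Rightarrow> nat \<Rightarrow> 'a::idom"
  assumes orth: "\<And>i j. i < p \<Longrightarrow> j < q \<Longrightarrow> (\<Sum>k<p + q. A i k * E j k) = 0"
  shows "det (stack p q A B) * det (stack p q C E)
    = det (gram (p + q) p A C) * det (gram (p + q) q B E)"
proof -
  let ?lower = "mat q p (\<lambda>(i, j). \<Sum>k<p + q. B i k * C j k)"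
  have "stack p q A B * transpose_mat (stack p q C E)
      = four_block_mat (gram (p + q) p A C) (0\<^sub>m p q) ?lower (gram (p + q) q B E)"
  proof (rule eq_matI, goal_cases)
    case (1 i j)
    then have ij: "i < p + q" "j < p + q" by (simp_all add: gram_def)
    have "(stack p q A B * transpose_mat (stack p q C E)) $$ (i, j)
      = (\<Sum>k<p + q. (if i < p then A i k else B (i - p) k) * (if j < p then C j k else E (j - p) k))"
      using ij by (simp add: stack_def scalar_prod_def lessThan_atLeast0)
    then show ?case using ij orth[of i "j - p"] by (auto simp: gram_def)
  qed (simp_all add: stack_def gram_def)
  then have "det (stack p q A B * transpose_mat (stack p q C E))
      = det (gram (p + q) p A C) * det (gram (p + q) q B E)"
    by (simp add: det_four_block_mat_upper_right_zero[where n = p and m = q] gram_def)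
  then show ?thesis
    by (simp add: det_mult[where n = "p + q"] det_transpose[where n = "p + q"])
qed

lemma det_scale_columns:
  "det (mat n n (\<lambda>(i, k). A i k * w k)) = det (mat n n (\<lambda>(i, k). A i k)) * (\<Prod>k<n. w k)"
  for A :: "nat \<Rightarrow> nat \<Rightarrow> 'a::comm_ring_1"
proof -
  have "mat n n (\<lambda>(i, k). A i k) * mat_diag n w
      = mat n n (\<lambda>(i, k). mat n n (\<lambda>(i, k). A i k) $$ (i, k) * w k)"
    by (rule mat_diag_mult_right) simp
  then have "mat n n (\<lambda>(i, k). A i k * w k) = mat n n (\<lambda>(i, k). A i k) * mat_diag n w"
    by (auto cong: cong_mat)
  moreover have "det (mat_diag n w) = (\<Prod>k<n. w k)"
    by (subst det_upper_triangular[where n = n])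
      (auto simp: prod_list_diag_prod lessThan_atLeast0 mat_diag_def)
  ultimately show ?thesis by (simp add: det_mult[where n = n])
qed

lemma det_scalar_gram:
  assumes "\<And>i j. i < p \<Longrightarrow> j < p \<Longrightarrow> (\<Sum>k<n. A i k * X j k) = (if i = j then \<gamma> else 0)"
  shows "det (gram n p A X) = \<gamma> ^ p"
proof -
  have "gram n p A X = \<gamma> \<cdot>\<^sub>m 1\<^sub>m p"
    by (rule eq_matI) (use assms in \<open>simp_all add: gram_def\<close>)
  then show ?thesis by simp
qed

text \<open>
  The algebraic core. The rows of \<open>P\<close> are orthogonal to those of \<open>Q\<close> for
  the sesquilinear form given by \<open>bar\<close>, and the numbers of rows add up to the number of
  columns. The right inverses up to the coprime factors \<open>\<alpha>\<close> and
  \<open>\<beta>\<close> express that the maximal minors of \<open>P\<close>, and those of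
  \<open>Q\<close>, have no common factor: they let a determinant be cancelled from a product with a
  power of \<open>\<alpha>\<close> and with one of \<open>\<beta>\<close>. Both Gram determinants
  turn out to be associated to the determinant \<open>m\<close> of \<open>P\<close> stacked upon
  \<open>Q w\<close>, unless \<open>m\<close> and with it both of them vanish.
\<close>

lemma complementary_gram_dets_associated:
  fixes P Q :: "nat \<Rightarrow> nat \<Rightarrow> 'a::idom" and w :: "nat \<Rightarrow> 'a" and bar :: "'a \<Rightarrow> 'a"
  assumes bar: "comm_ring_hom bar" "\<And>a. bar (bar a) = a"
    and w: "\<And>k. k < p + q \<Longrightarrow> w k * w k = 1" "\<And>k. k < p + q \<Longrightarrow> bar (w k) = w k"
    and orth: "\<And>i j. i < p \<Longrightarrow> j < q \<Longrightarrow> (\<Sum>k<p + q. P i k * bar (Q j k)) = 0"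
    and coprime: "\<And>a N M. \<alpha> ^ N dvd a * \<beta> ^ M \<Longrightarrow> \<alpha> ^ N dvd a"
    and nonzero: "\<alpha> \<noteq> 0"
    and P: "\<And>\<gamma>. \<gamma> \<in> {\<alpha>, \<beta>} \<Longrightarrow>
      \<exists>X. \<forall>i<p. \<forall>j<p. (\<Sum>k<p + q. P i k * X j k) = (if i = j then \<gamma> else 0)"
    and Q: "\<And>\<gamma>. \<gamma> \<in> {\<alpha>, \<beta>} \<Longrightarrow>
      \<exists>X. \<forall>i<q. \<forall>j<q. (\<Sum>k<p + q. Q i k * X j k) = (if i = j then \<gamma> else 0)"
  shows "\<exists>u. u dvd 1 \<and>
    det (gram (p + q) q (\<lambda>i k. Q i k * w k) (\<lambda>i k. bar (Q i k)))
      = u * det (gram (p + q) p (\<lambda>i k. P i k * w k) (\<lambda>i k. bar (P i k)))"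
    (is "\<exists>u. u dvd 1 \<and> ?l' = u * ?l")
proof -
  let ?n = "p + q"
  interpret bar: comm_ring_hom bar by (rule bar(1))
  define m where "m = det (stack p q P (\<lambda>i k. Q i k * w k))"
  define \<omega> where "\<omega> = (\<Prod>k<?n. w k)"
  have \<omega>: "\<omega> * \<omega> = 1"
    unfolding \<omega>_def by (subst prod.distrib[symmetric]) (simp add: w(1))
  have orth': "(\<Sum>k<?n. bar (P i k) * Q j k) = 0" if "i < p" "j < q" for i j
    using arg_cong[OF orth[OF that], of bar] by (simp add: bar.hom_sum bar.hom_mult bar(2))
  have ww: "a * w k * (b * w k) = a * b" if "k < ?n" for a b k
  proof -
    have "a * w k * (b * w k) = a * b * (w k * w k)" by (simp only: ac_simps)
    then show ?thesis by (simp add: w(1) that)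
  qed
  have orth_w: "(\<Sum>k<?n. bar (P i k) * w k * (Q j k * w k)) = 0" if "i < p" "j < q" for i j
    using orth'[OF that] by (simp add: ww)
  \<comment> \<open>The weights sit in the lower block of the matrix defining \<open>m\<close> and in the upper block of this
    one; as \<open>w k * w k = 1\<close>, scaling all columns by the weights moves them from one to the other.\<close>
  let ?T = "stack p q (\<lambda>i k. bar (P i k) * w k) (\<lambda>i k. bar (Q i k))"
  have "bar m = det (map_mat bar (stack p q P (\<lambda>i k. Q i k * w k)))"
    by (simp add: m_def)
  also have "map_mat bar (stack p q P (\<lambda>i k. Q i k * w k))
      = mat ?n ?n (\<lambda>(i, k). (if i < p then bar (P i k) * w k else bar (Q (i - p) k)) * w k)"
    by (rule eq_matI) (auto simp: stack_def bar.hom_mult w mult.assoc)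
  finally have T: "bar m = det ?T * \<omega>"
    unfolding \<omega>_def stack_def det_scale_columns .
  have "gram ?n p P (\<lambda>i k. bar (P i k) * w k) = gram ?n p (\<lambda>i k. P i k * w k) (\<lambda>i k. bar (P i k))"
    by (simp add: gram_def ac_simps)
  then have ll': "m * det ?T = ?l * ?l'"
    unfolding m_def by (simp add: det_stack_mult orth)
  have norm: "?l * ?l' = \<omega> * (m * bar m)"
    unfolding ll'[symmetric] T using \<omega> by (simp add: mult.left_commute[of \<omega>] mult.assoc)
  \<comment> \<open>Comparing the two multiples of \<open>m\<close> shows that the factor \<open>b\<close> with \<open>a * \<alpha> ^ r = m * b\<close> is
    itself divisible by \<open>\<alpha> ^ r\<close>.\<close>
  have cancel: "m dvd a" if a: "\<And>\<gamma>. \<gamma> \<in> {\<alpha>, \<beta>} \<Longrightarrow> m dvd a * \<gamma> ^ r" for a r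
  proof (cases "m = 0")
    case True
    with a[of \<alpha>] nonzero show ?thesis by simp
  next
    case False
    obtain b where b: "a * \<alpha> ^ r = m * b" using a[of \<alpha>] by auto
    obtain b' where b': "a * \<beta> ^ r = m * b'" using a[of \<beta>] by auto
    have "m * (b * \<beta> ^ r) = a * \<alpha> ^ r * \<beta> ^ r" by (simp add: b mult.assoc)
    also have "\<dots> = (a * \<beta> ^ r) * \<alpha> ^ r" by (simp only: ac_simps)
    also have "\<dots> = m * (b' * \<alpha> ^ r)" by (simp only: b' mult.assoc)
    finally have "b * \<beta> ^ r = b' * \<alpha> ^ r" using False by simp
    then have "\<alpha> ^ r dvd b" by (intro coprime[of r b r]) simp
    then obtain b'' where "b = \<alpha> ^ r * b''" by auto
    with b have "\<alpha> ^ r * a = \<alpha> ^ r * (m * b'')" by (simp add: ac_simps)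
    with nonzero have "a = m * b''" by simp
    then show ?thesis by simp
  qed
  have "m dvd ?l'"
  proof (rule cancel)
    fix \<gamma> assume "\<gamma> \<in> {\<alpha>, \<beta>}"
    from P[OF this] obtain X
      where X: "\<forall>i<p. \<forall>j<p. (\<Sum>k<?n. P i k * X j k) = (if i = j then \<gamma> else 0)"
      by (elim exE)
    have "m * det (stack p q X (\<lambda>i k. bar (Q i k))) = \<gamma> ^ p * ?l'"
      unfolding m_def by (subst det_stack_mult) (simp_all add: orth X det_scalar_gram)
    then show "m dvd ?l' * \<gamma> ^ p" by (metis dvd_triv_left mult.commute)
  qed
  then obtain t where t: "?l' = m * t" by (elim dvdE)
  have "m dvd ?l"
  proof (rule cancel)
    fix \<gamma> assume "\<gamma> \<in> {\<alpha>, \<beta>}"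
    from Q[OF this] obtain X
      where X: "\<forall>i<q. \<forall>j<q. (\<Sum>k<?n. Q i k * X j k) = (if i = j then \<gamma> else 0)"
      by (elim exE)
    have "det (gram ?n q (\<lambda>i k. X i k * w k) (\<lambda>i k. Q i k * w k)) = \<gamma> ^ q"
      by (subst det_gram_commute, rule det_scalar_gram) (simp add: ww X)
    moreover have "det (gram ?n p (\<lambda>i k. bar (P i k) * w k) P) = ?l"
      by (subst det_gram_commute) (simp add: gram_def ac_simps)
    ultimately have eq: "det (stack p q (\<lambda>i k. bar (P i k) * w k) (\<lambda>i k. X i k * w k)) * m = ?l * \<gamma> ^ q"
      unfolding m_def by (simp only: det_stack_mult[OF orth_w])
    show "m dvd ?l * \<gamma> ^ q" unfolding eq[symmetric] by (rule dvd_triv_right)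
  qed
  then obtain s where s: "?l = m * s" by (elim dvdE)
  show ?thesis
  proof (cases "m = 0")
    case True
    with s t show ?thesis by (intro exI[of _ 1]) simp
  next
    case False
    \<comment> \<open>The identity \<open>norm\<close> now reads \<open>m s m t = \<omega> m (bar m)\<close>; cancelling \<open>m\<close> and applying \<open>bar\<close>
      once more expresses \<open>m\<close> as a multiple of itself.\<close>
    have "m * (m * (s * t)) = m * (\<omega> * bar m)"
      using norm unfolding s t by (simp add: ac_simps)
    with False have st: "m * (s * t) = \<omega> * bar m" by simp
    then have bar_m: "bar m = \<omega> * (m * (s * t))" using \<omega> by (metis mult.assoc mult_1)
    have "bar \<omega> = \<omega>" by (simp add: \<omega>_def bar.hom_prod w(2))
    then have "m = \<omega> * (bar m * bar (s * t))"
      using arg_cong[OF bar_m, of bar] by (simp add: bar.hom_mult bar(2))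
    then have "m * 1 = m * (s * t * bar (s * t))"
      using \<omega> unfolding bar_m by (metis mult.assoc mult.commute mult_1)
    with False have unit: "s * (t * bar (s * t)) = 1" by (metis mult.assoc mult_left_cancel)
    define u where "u = t * (t * bar (s * t))"
    have "u * s = t" using unit unfolding u_def by (metis mult.assoc mult.commute mult_1)
    then have "?l' = u * ?l" unfolding s t by (simp add: ac_simps)
    moreover have "u dvd 1"
    proof -
      have "t dvd 1" using unit by (metis dvd_triv_left mult.assoc mult.left_commute)
      moreover have "t * bar (s * t) dvd 1" using unit by (metis dvd_triv_right)
      ultimately show ?thesis unfolding u_def by (metis mult_dvd_mono mult_1)
    qed
    ultimately show ?thesis by blast
  qed
qed

text \<open>
  Greatest common divisors of the same elements divide each other.
\<close>

lemma module_order_associated: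
  fixes \<Delta> \<Delta>\<^sub>0 :: "'a::idom"
  assumes "module_order M \<Delta>" "module_order M \<Delta>\<^sub>0"
  shows "\<exists>u. u dvd 1 \<and> \<Delta> = u * \<Delta>\<^sub>0"
proof -
  have "\<Delta> dvd \<Delta>\<^sub>0" "\<Delta>\<^sub>0 dvd \<Delta>" using assms unfolding module_order_def by blast+
  then obtain s t where s: "\<Delta>\<^sub>0 = \<Delta> * s" and t: "\<Delta> = \<Delta>\<^sub>0 * t" by (elim dvdE)
  show ?thesis
  proof (cases "\<Delta> = 0")
    case True
    with s show ?thesis by (intro exI[of _ 1]) simp
  next
    case False
    have "\<Delta> * (s * t) = \<Delta>" unfolding mult.assoc[symmetric] s[symmetric] t[symmetric] ..
    then have "\<Delta> * 1 = \<Delta> * (s * t)" by simp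
    with False have "1 = s * t" by (metis mult_left_cancel)
    then have "t dvd 1" by (metis dvd_triv_right)
    then show ?thesis using t by (intro exI[of _ t]) (simp add: mult.commute)
  qed
qed


section \<open>Crossings, regions and shadings\<close>

locale torus_diagram =
  fixes D :: "'d link_diagram"
  assumes torus: "torus_link_diagram D"
begin

text \<open>
  The successor of a corner in the boundary walk of its region.
\<close>

definition next_corner :: "'d \<Rightarrow> 'd" where
  "next_corner d = flip D (rot D d)"

lemma finite_darts: "finite (darts D)"
  and rot_permutes: "rot D permutes darts D"
  and flip_permutes: "flip D permutes darts D"
  and card_rot_orbit: "d \<in> darts D \<Longrightarrow> card (orbit (rot D) d) = 4"
  and flip_neq: "d \<in> darts D \<Longrightarrow> flip D d \<noteq> d"
  and flip_flip [simp]: "d \<in> darts D \<Longrightarrow> flip D (flip D d) = d"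
  and over_rot [simp]: "d \<in> darts D \<Longrightarrow> over D (rot D d) \<longleftrightarrow> \<not> over D d"
  and connected: "d \<in> darts D \<Longrightarrow> d' \<in> darts D \<Longrightarrow>
    (d, d') \<in> {(a, b). b = rot D a \<or> b = flip D a}\<^sup>*"
  and euler: "int (card (crossings D)) - int (card (edges D)) + int (card (regions D)) = 0"
  using torus unfolding torus_link_diagram_def by blast+

lemma permutation_of_darts: "g permutes darts D \<Longrightarrow> permutation g"
  unfolding permutation_permutes using finite_darts by (intro exI conjI)

lemma rot_in_darts [simp]: "rot D d \<in> darts D \<longleftrightarrow> d \<in> darts D"
  by (rule permutes_in_image[OF rot_permutes])

lemma flip_in_darts [simp]: "flip D d \<in> darts D \<longleftrightarrow> d \<in> darts D"
  by (rule permutes_in_image[OF flip_permutes])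

lemma next_corner_permutes: "next_corner permutes darts D"
  using permutes_compose[OF rot_permutes flip_permutes]
  by (simp add: next_corner_def[abs_def] comp_def)

lemma next_corner_in_darts [simp]: "next_corner d \<in> darts D \<longleftrightarrow> d \<in> darts D"
  by (simp add: next_corner_def)

lemma region_eq_orbit: "region D d = orbit next_corner d"
  by (simp add: region_def next_corner_def[abs_def])

lemma self_in_region: "d \<in> region D d"
  unfolding region_eq_orbit
  by (rule permutation_self_in_orbit[OF permutation_of_darts[OF next_corner_permutes]])

lemma region_cyclic: "cyclic_on next_corner (region D d)"
  unfolding region_eq_orbit by (rule cyclic_on_orbit[OF next_corner_permutes finite_darts])

lemma region_eqI: "d' \<in> region D d \<Longrightarrow> region D d' = region D d"
  using orbit_cyclic_eq3[OF region_cyclic] by (simp add: region_eq_orbit)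

lemma region_next_corner [simp]: "region D (next_corner d) = region D d"
  by (rule region_eqI) (simp add: region_eq_orbit orbit.base)

lemma region_flip_rot [simp]: "region D (flip D (rot D d)) = region D d"
  using region_next_corner[of d] by (simp add: next_corner_def)

lemma region_eq_iff: "region D d' = region D d \<longleftrightarrow> d' \<in> region D d"
  using region_eqI self_in_region by metis

lemma region_subset_darts: "d \<in> darts D \<Longrightarrow> region D d \<subseteq> darts D"
  unfolding region_eq_orbit by (rule permutes_orbit_subset[OF next_corner_permutes])

lemma orbit_rot_eq:
  assumes "d \<in> darts D"
  shows "orbit (rot D) d = {d, rot D d, rot D (rot D d), rot D (rot D (rot D d))}"
    and rot4: "rot D (rot D (rot D (rot D d))) = d"
proof -
  let ?N = "funpow_dist1 (rot D) d d"
  have self: "d \<in> orbit (rot D) d"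
    by (rule permutation_self_in_orbit[OF permutation_of_darts[OF rot_permutes]])
  have "card (orbit (rot D) d) = card {0..<?N}"
    by (subst orbit_conv_funpow_dist1[OF self]) (rule card_image[OF inj_on_funpow_dist1[OF self]])
  then have N: "?N = 4" using card_rot_orbit[OF assms] by simp
  show "rot D (rot D (rot D (rot D d))) = d"
    using funpow_dist1_prop[OF self] unfolding N by (simp add: eval_nat_numeral)
  show "orbit (rot D) d = {d, rot D d, rot D (rot D d), rot D (rot D (rot D d))}"
    by (subst orbit_conv_funpow_dist1[OF self], unfold N)
      (auto simp: eval_nat_numeral atLeast0_lessThan_Suc)
qed

lemma rot_rot_neq: "d \<in> darts D \<Longrightarrow> rot D (rot D d) \<noteq> d"
proof
  assume d: "d \<in> darts D" and "rot D (rot D d) = d"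
  then have "orbit (rot D) d = {d, rot D d}" by (auto simp: orbit_rot_eq)
  then have "card (orbit (rot D) d) \<le> 2" by (simp add: card_insert_if)
  with card_rot_orbit[OF d] show False by simp
qed

lemma orbit_rot_rot: "orbit (rot D) (rot D d) = orbit (rot D) d"
  by (rule permutation_orbit_step[OF permutation_of_darts[OF rot_permutes]])

lemma crossing_eqI: "d' \<in> orbit (rot D) d \<Longrightarrow> orbit (rot D) d' = orbit (rot D) d"
  using orbit_cyclic_eq3[OF cyclic_on_orbit[OF rot_permutes finite_darts]] .

lemma self_in_crossing: "d \<in> orbit (rot D) d"
  by (rule permutation_self_in_orbit[OF permutation_of_darts[OF rot_permutes]])

lemma crossing_subset_darts: "d \<in> darts D \<Longrightarrow> orbit (rot D) d \<subseteq> darts D"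
  by (rule permutes_orbit_subset[OF rot_permutes])

lemma crossings_partition:
  shows "\<Union> (crossings D) = darts D" and "finite (crossings D)"
    and "v \<in> crossings D \<Longrightarrow> v' \<in> crossings D \<Longrightarrow> v \<noteq> v' \<Longrightarrow> v \<inter> v' = {}"
proof -
  show "\<Union> (crossings D) = darts D"
    using crossing_subset_darts self_in_crossing by (auto simp: crossings_def)
  show "finite (crossings D)" by (simp add: crossings_def finite_darts)
  show "v \<in> crossings D \<Longrightarrow> v' \<in> crossings D \<Longrightarrow> v \<noteq> v' \<Longrightarrow> v \<inter> v' = {}"
    unfolding crossings_def by (elim imageE) (metis crossing_eqI disjoint_iff)
qed

lemma card_crossings: "4 * card (crossings D) = card (darts D)"
proof -
  have "4 * card (crossings D) = card (\<Union> (crossings D))"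
  proof (rule card_partition)
    show "card v = 4" if "v \<in> crossings D" for v
      using that card_rot_orbit by (auto simp: crossings_def)
  qed (simp_all add: crossings_partition finite_darts)
  then show ?thesis by (simp add: crossings_partition)
qed

lemma card_edges: "2 * card (edges D) = card (darts D)"
proof -
  have "\<Union> (edges D) = darts D" by (auto simp: edges_def)
  moreover have "2 * card (edges D) = card (\<Union> (edges D))"
  proof (rule card_partition)
    show "card e = 2" if "e \<in> edges D" for e
    proof -
      from that obtain d where "d \<in> darts D" "e = {d, flip D d}" by (auto simp: edges_def)
      with flip_neq[of d] show ?thesis by (simp add: card_insert_if eq_commute)
    qed
    show "e \<inter> e' = {}" if "e \<in> edges D" "e' \<in> edges D" "e \<noteq> e'" for e e'
    proof -
      have "e = {x, flip D x}" if "e \<in> edges D" "x \<in> e" for e x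
      proof -
        from that obtain d where d: "d \<in> darts D" "e = {d, flip D d}" by (auto simp: edges_def)
        with \<open>x \<in> e\<close> have "x = d \<or> x = flip D d" by blast
        then show ?thesis using d by (elim disjE) (simp_all add: insert_commute)
      qed
      with that show ?thesis by (metis disjoint_iff)
    qed
  qed (auto simp: edges_def finite_darts)
  ultimately show ?thesis by simp
qed

text \<open>
  The only consequence of the Euler characteristic that enters the proof: it makes the stack of
  the two boundary matrices square. Each crossing has four darts and each edge has two.
\<close>

lemma card_regions: "card (regions D) = card (crossings D)"
  using euler card_crossings card_edges by linarith

lemma sum_flip: "(\<Sum>d\<in>darts D. g (flip D d)) = (\<Sum>d\<in>darts D. g d)"
  using sum.permute[OF flip_permutes, of g] by (simp add: comp_def)

end


locale shaded_diagram = torus_diagram +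
  fixes Sh :: "'a set set"
  assumes shading: "checkerboard_shading D Sh"
begin

definition shaded :: "'a set" where
  "shaded = {d \<in> darts D. region D d \<in> Sh}"

lemma shaded_subset: "shaded \<subseteq> darts D"
  by (auto simp: shaded_def)

lemma finite_shaded: "finite shaded"
  by (rule finite_subset[OF shaded_subset finite_darts])

lemma flip_shaded [simp]: "d \<in> darts D \<Longrightarrow> flip D d \<in> shaded \<longleftrightarrow> d \<notin> shaded"
  using shading unfolding shaded_def checkerboard_shading_def mem_Collect_eq flip_in_darts by blast

lemma next_corner_shaded [simp]: "next_corner d \<in> shaded \<longleftrightarrow> d \<in> shaded"
  by (simp add: shaded_def)

text \<open>
  The corners \<open>d\<close> and \<open>rot D d\<close> lie on the two sides of the edge of
  \<open>rot D d\<close>.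
\<close>

lemma rot_shaded [simp]: "d \<in> darts D \<Longrightarrow> rot D d \<in> shaded \<longleftrightarrow> d \<notin> shaded"
  using flip_shaded[of "rot D d"] next_corner_shaded[of d] by (auto simp: next_corner_def)

lemma card_shaded: "2 * card shaded = card (darts D)"
proof -
  have "bij_betw (rot D) shaded (darts D - shaded)"
  proof (rule bij_betw_imageI)
    show "inj_on (rot D) shaded" using permutes_inj_on[OF rot_permutes] .
    show "rot D ` shaded = darts D - shaded"
    proof (intro equalityI subsetI)
      fix d assume d: "d \<in> darts D - shaded"
      have "d = rot D (rot D (rot D (rot D d)))" using d by (simp add: rot4)
      moreover have "rot D (rot D (rot D d)) \<in> shaded" using d by simp
      ultimately show "d \<in> rot D ` shaded" by blast
    qed (use shaded_subset in auto)
  qed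
  then have "card shaded = card (darts D - shaded)" by (rule bij_betw_same_card)
  also have "\<dots> = card (darts D) - card shaded"
    by (rule card_Diff_subset[OF finite_shaded shaded_subset])
  finally show ?thesis using card_mono[OF finite_darts shaded_subset] by simp
qed

text \<open>
  A crossing has two shaded corners, which are opposite. Choosing one of them for every crossing
  enumerates the edges of the Tait graph and orients them.
\<close>

definition crossing_darts :: "'a list \<Rightarrow> bool" where
  "crossing_darts es \<longleftrightarrow> distinct es \<and>
     set es \<inter> (\<lambda>d. rot D (rot D d)) ` set es = {} \<and>
     set es \<union> (\<lambda>d. rot D (rot D d)) ` set es = shaded"

lemma inj_rot_rot: "inj (\<lambda>d. rot D (rot D d))"
  using permutes_inj[OF rot_permutes] by (auto intro!: injI dest: injD)

lemma sum_crossing_darts: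
  assumes "crossing_darts es"
  shows "(\<Sum>k<length es. g (es ! k) + g (rot D (rot D (es ! k)))) = (\<Sum>d\<in>shaded. g d)"
proof -
  have dist: "distinct es"
    and disj: "set es \<inter> (\<lambda>d. rot D (rot D d)) ` set es = {}"
    and un: "set es \<union> (\<lambda>d. rot D (rot D d)) ` set es = shaded"
    using assms by (simp_all add: crossing_darts_def)
  have "bij_betw (\<lambda>k. es ! k) {..<length es} (set es)"
    by (rule bij_betw_nth) (use dist in auto)
  then have "(\<Sum>k<length es. g (es ! k) + g (rot D (rot D (es ! k))))
      = (\<Sum>d\<in>set es. g d + g (rot D (rot D d)))"
    by (rule sum.reindex_bij_betw)
  also have "\<dots> = (\<Sum>d\<in>set es. g d) + (\<Sum>d\<in>(\<lambda>d. rot D (rot D d)) ` set es. g d)"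
    by (simp add: sum.distrib sum.reindex inj_on_subset[OF inj_rot_rot])
  also have "\<dots> = (\<Sum>d\<in>shaded. g d)"
    unfolding un[symmetric] by (rule sum.union_disjoint[symmetric]) (use disj in auto)
  finally show ?thesis .
qed

lemma length_crossing_darts:
  assumes "crossing_darts es" shows "length es = card (crossings D)"
proof -
  have "(\<Sum>k<length es. (1::nat) + 1) = (\<Sum>d\<in>shaded. 1)"
    using sum_crossing_darts[OF assms, of "\<lambda>_. 1"] .
  then show ?thesis using card_shaded card_crossings by simp
qed

lemma crossing_darts_exist: "\<exists>es. crossing_darts es"
proof -
  define pick where "pick v = (SOME d. d \<in> v \<and> d \<in> shaded)" for v
  have pick: "pick (orbit (rot D) d) \<in> orbit (rot D) d \<and> pick (orbit (rot D) d) \<in> shaded"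
    if "d \<in> darts D" for d
    unfolding pick_def
  proof (rule someI_ex, cases "d \<in> shaded")
    case True
    then show "\<exists>x. x \<in> orbit (rot D) d \<and> x \<in> shaded" using self_in_crossing[of d] by blast
  next
    case False
    then have "rot D d \<in> shaded" using that by simp
    then show "\<exists>x. x \<in> orbit (rot D) d \<and> x \<in> shaded" using orbit.base[of "rot D" d] by blast
  qed
  have pick_pick: "pick (orbit (rot D) (pick (orbit (rot D) d))) = pick (orbit (rot D) d)"
    if "d \<in> darts D" for d
    by (rule arg_cong[where f = pick], rule crossing_eqI) (use pick[OF that] in blast)
  let ?T = "pick ` crossings D"
  have "finite ?T" by (rule finite_imageI[OF crossings_partition(2)])
  from finite_distinct_list[OF this] obtain es where es: "set es = ?T \<and> distinct es" ..
  have T: "\<exists>d. d \<in> darts D \<and> e = pick (orbit (rot D) d)" if "e \<in> ?T" for e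
    using that unfolding crossings_def by blast
  have T_shaded: "e \<in> shaded" if "e \<in> ?T" for e
    using T[OF that] pick by blast
  have T_eq: "e = e'" if "e \<in> ?T" "e' \<in> ?T" "orbit (rot D) e = orbit (rot D) e'" for e e'
    using T[OF that(1)] T[OF that(2)] that(3) pick_pick by metis
  have "?T \<inter> (\<lambda>d. rot D (rot D d)) ` ?T = {}"
  proof (rule equals0I)
    fix e assume "e \<in> ?T \<inter> (\<lambda>d. rot D (rot D d)) ` ?T"
    then obtain e' where e: "e \<in> ?T" "e' \<in> ?T" "e = rot D (rot D e')" by blast
    then have "e = e'" by (intro T_eq) (simp_all only: orbit_rot_rot)
    moreover have "e' \<in> darts D" using T_shaded[OF e(2)] shaded_subset by blast
    ultimately show False using rot_rot_neq[of e'] e(3) by simp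
  qed
  moreover have "?T \<union> (\<lambda>d. rot D (rot D d)) ` ?T = shaded"
  proof (intro equalityI subsetI)
    have "rot D (rot D e) \<in> shaded" if "e \<in> shaded" for e
    proof -
      have "e \<in> darts D" using that shaded_subset by blast
      with that show ?thesis by simp
    qed
    then show "d \<in> shaded" if "d \<in> ?T \<union> (\<lambda>d. rot D (rot D d)) ` ?T" for d
      using that T_shaded by blast
  next
    fix d assume d: "d \<in> shaded"
    then have dD: "d \<in> darts D" using shaded_subset by blast
    define e where "e = pick (orbit (rot D) d)"
    have e: "e \<in> shaded" "e \<in> orbit (rot D) d" using pick[OF dD] by (simp_all add: e_def)
    then have eD: "e \<in> darts D" using shaded_subset by blast
    have "d \<in> orbit (rot D) e" using crossing_eqI[OF e(2)] self_in_crossing[of d] by simp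
    then have "d \<in> {e, rot D e, rot D (rot D e), rot D (rot D (rot D e))}"
      by (simp only: orbit_rot_eq(1)[OF eD])
    moreover have "rot D e \<notin> shaded" "rot D (rot D (rot D e)) \<notin> shaded"
      using e(1) eD by simp_all
    ultimately have "d = e \<or> d = rot D (rot D e)" using d by blast
    moreover have "e \<in> ?T" using dD unfolding e_def crossings_def by blast
    ultimately show "d \<in> ?T \<union> (\<lambda>d. rot D (rot D d)) ` ?T" by blast
  qed
  ultimately have "crossing_darts es" using es by (simp only: crossing_darts_def)
  then show ?thesis ..
qed

end

lemma (in shaded_diagram) complementary: "shaded_diagram D (regions D - Sh)"
proof
  have region: "region D d \<in> regions D" if "d \<in> darts D" for d
    using that by (simp add: regions_def)
  show "checkerboard_shading D (regions D - Sh)"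
    unfolding checkerboard_shading_def
  proof (intro conjI ballI)
    fix d assume d: "d \<in> darts D"
    have "region D d \<in> Sh \<longleftrightarrow> region D (flip D d) \<notin> Sh"
      using shading d unfolding checkerboard_shading_def by blast
    moreover have "region D (flip D d) \<in> regions D" using d by (intro region) simp
    ultimately show "region D d \<in> regions D - Sh \<longleftrightarrow> region D (flip D d) \<notin> regions D - Sh"
      using region[OF d] by blast
  qed blast
qed

lemma (in shaded_diagram) shaded_complementary:
  "shaded_diagram.shaded D (regions D - Sh) = darts D - shaded"
  unfolding shaded_diagram.shaded_def[OF complementary] by (auto simp: shaded_def regions_def)

text \<open>
  Turning by one corner at every crossing gives the dual edges, listed in the same order.
\<close>

lemma (in shaded_diagram) crossing_darts_complementary:
  assumes es: "crossing_darts es"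
  shows "shaded_diagram.crossing_darts D (regions D - Sh) (map (rot D) es)"
proof -
  let ?r = "rot D"
  have inj: "inj ?r" by (rule permutes_inj[OF rot_permutes])
  have img: "?r ` shaded = darts D - shaded"
  proof (intro equalityI subsetI)
    fix d assume d: "d \<in> darts D - shaded"
    then have "d = ?r (?r (?r (?r d)))" by (simp add: rot4)
    moreover have "?r (?r (?r d)) \<in> shaded" using d by simp
    ultimately show "d \<in> ?r ` shaded" by blast
  qed (use shaded_subset in auto)
  let ?E = "set es" and ?E' = "(\<lambda>d. ?r (?r d)) ` set es"
  have "distinct es" and disj: "?E \<inter> ?E' = {}" and un: "?E \<union> ?E' = shaded"
    using es by (simp_all add: crossing_darts_def)
  then have "distinct (map ?r es)"
    using inj by (simp add: distinct_map inj_on_def)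
  moreover have "(\<lambda>d. ?r (?r d)) ` set (map ?r es) = ?r ` ?E'" by auto
  moreover have "?r ` ?E \<inter> ?r ` ?E' = {}"
    using disj by (simp flip: image_Int[OF inj])
  moreover have "?r ` ?E \<union> ?r ` ?E' = darts D - shaded"
    unfolding image_Un[symmetric] un img ..
  ultimately show ?thesis
    unfolding shaded_diagram.crossing_darts_def[OF complementary] shaded_complementary by simp
qed


section \<open>Voltages and lifted regions\<close>

text \<open>
  The potential of \<open>x\<close> is the negative of the sum of \<open>c\<close> along the path
  from \<open>x\<close> to a base point of its cycle. The step at the base point itself is
  consistent because the sum of \<open>c\<close> around the cycle vanishes.
\<close>

lemma cyclic_potential:
  fixes c :: "'d \<Rightarrow> 'a::ab_group_add"
  assumes f: "permutation f" and sum0: "\<And>x. x \<in> X \<Longrightarrow> sum c (orbit f x) = 0"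
  shows "\<exists>s. \<forall>x\<in>X. s (f x) = s x + c (f x)"
proof -
  define base where "base x = (SOME y. y \<in> orbit f x)" for x
  have base: "base x \<in> orbit f x" for x
    unfolding base_def by (rule someI[of _ x]) (rule permutation_self_in_orbit[OF f])
  have base_f: "base (f x) = base x" for x
    by (simp only: base_def permutation_orbit_step[OF f])
  define s where "s x = - (\<Sum>j<funpow_dist f x (base x). c ((f ^^ j) (f x)))" for x
  have "s (f x) = s x + c (f x)" if "x \<in> X" for x
  proof (cases "x = base x")
    case False
    have dist: "funpow_dist f x (base x) = Suc (funpow_dist f (f x) (base x))"
      by (rule funpow_dist_step[OF False base])
    show ?thesis
      unfolding s_def base_f dist
      by (simp add: sum.lessThan_Suc_shift funpow_swap1 del: sum.lessThan_Suc)
  next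
    case True
    let ?N = "funpow_dist f (f x) x"
    have self: "x \<in> orbit f x" by (rule permutation_self_in_orbit[OF f])
    have inj: "inj f" using f by (simp add: permutation_bijective bij_is_inj)
    have "s (f x) = - (\<Sum>j<?N. c ((f ^^ j) (f (f x))))"
      unfolding s_def base_f using True by simp
    then have "c (f x) - s (f x) = (\<Sum>j<Suc ?N. c ((f ^^ j) (f x)))"
      by (simp add: sum.lessThan_Suc_shift funpow_swap1 del: sum.lessThan_Suc)
    also have "\<dots> = (\<Sum>j\<in>{0..<Suc ?N}. c (f ((f ^^ j) x)))"
      by (simp only: funpow_swap1 lessThan_atLeast0)
    also have "\<dots> = (\<Sum>y\<in>(\<lambda>j. (f ^^ j) x) ` {0..<Suc ?N}. c (f y))"
      by (simp only: sum.reindex[OF inj_on_funpow_dist1[OF self]] comp_def)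
    also have "\<dots> = (\<Sum>y\<in>orbit f x. c (f y))"
      by (simp only: orbit_conv_funpow_dist1[OF self, symmetric])
    also have "\<dots> = (\<Sum>y\<in>f ` orbit f x. c y)"
      by (subst sum.reindex) (use inj in \<open>auto simp: inj_on_def\<close>)
    also have "f ` orbit f x = orbit f (f x)"
      by (rule orbit_inverse[OF self]) simp
    also have "orbit f (f x) = orbit f x"
      by (rule permutation_orbit_step[OF f])
    finally have "c (f x) = s (f x)" using sum0[OF that] by simp
    moreover have "s x = 0"
      unfolding s_def using True by (simp add: funpow_dist_0)
    ultimately show ?thesis by simp
  qed
  then show ?thesis by blast
qed

context torus_diagram
begin

lemma rot_image_crossing:
  assumes "d \<in> darts D" shows "rot D ` orbit (rot D) d = orbit (rot D) d"
  unfolding orbit_rot_eq(1)[OF assms] image_insert image_empty rot4[OF assms] by blast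

lemma cycle_group_iff:
  "k \<in> carrier (cycle_group D) \<longleftrightarrow> (\<forall>d. d \<notin> darts D \<longrightarrow> k d = 0) \<and>
     (\<forall>d\<in>darts D. (\<Sum>e\<in>orbit (rot D) d. k e) = (\<Sum>e\<in>orbit (rot D) d. k (flip D e)))"
  by (simp add: cycle_group_def crossings_def sum_subtractf)

text \<open>
  An edge traversed in both directions, and below the boundary of a region, are the two kinds of
  null-homologous cycles from which the properties of voltages are read off.
\<close>

lemma edge_cycle:
  assumes d: "d \<in> darts D"
  shows "(\<lambda>e. of_bool (e \<in> {d, flip D d})) \<in> carrier (cycle_group D)"
    and "(\<lambda>e. of_bool (e \<in> {d, flip D d})) \<in> boundaries D"
proof -
  have flip_eq: "flip D e = d \<longleftrightarrow> e = flip D d" "flip D e = flip D d \<longleftrightarrow> e = d"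
    if "e \<in> darts D" for e
    using flip_flip[OF that] flip_flip[OF d] by metis+
  have flip_iff: "flip D e \<in> {d, flip D d} \<longleftrightarrow> e \<in> {d, flip D d}" if "e \<in> darts D" for e
    unfolding insert_iff empty_iff flip_eq[OF that] by blast
  have edge_iff: "{e, flip D e} = {d, flip D d} \<longleftrightarrow> e \<in> {d, flip D d}" if "e \<in> darts D" for e
    unfolding doubleton_eq_iff insert_iff empty_iff flip_eq[OF that] by blast
  show "(\<lambda>e. of_bool (e \<in> {d, flip D d})) \<in> carrier (cycle_group D)"
    unfolding cycle_group_iff
  proof (intro conjI allI impI ballI)
    fix e :: 'd assume "e \<notin> darts D"
    then have "e \<notin> {d, flip D d}" using d flip_in_darts[of d] by blast
    then show "(of_bool (e \<in> {d, flip D d}) :: int) = 0" by simp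
  next
    fix v assume "v \<in> darts D"
    then show "(\<Sum>e\<in>orbit (rot D) v. (of_bool (e \<in> {d, flip D d}) :: int))
        = (\<Sum>e\<in>orbit (rot D) v. of_bool (flip D e \<in> {d, flip D d}))"
      by (intro sum.cong refl) (simp only: flip_iff subsetD[OF crossing_subset_darts])
  qed
  show "(\<lambda>e. of_bool (e \<in> {d, flip D d})) \<in> boundaries D"
    unfolding boundaries_def mem_Collect_eq
  proof (intro conjI allI impI)
    fix e :: 'd assume "e \<notin> darts D"
    then have "e \<notin> {d, flip D d}" using d flip_in_darts[of d] by blast
    then show "(of_bool (e \<in> {d, flip D d}) :: int) = 0" by simp
  next
    show "\<exists>m n. \<forall>e\<in>darts D. (of_bool (e \<in> {d, flip D d}) :: int) = m (region D e) + n {e, flip D e}"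
      by (rule exI[of _ "\<lambda>_. 0"], rule exI[of _ "\<lambda>E. of_bool (E = {d, flip D d})"], rule ballI)
        (simp only: edge_iff add_0_left)
  qed
qed

lemma region_cycle:
  assumes d: "d \<in> darts D"
  shows "(\<lambda>e. of_bool (e \<in> region D d)) \<in> carrier (cycle_group D)"
    and "(\<lambda>e. of_bool (e \<in> region D d)) \<in> boundaries D"
proof -
  have zero: "(of_bool (e \<in> region D d) :: int) = 0" if "e \<notin> darts D" for e
    using that region_subset_darts[OF d] by auto
  have flip_rot_iff: "flip D (rot D e) \<in> region D d \<longleftrightarrow> e \<in> region D d" for e
    by (simp flip: region_eq_iff)
  show "(\<lambda>e. of_bool (e \<in> region D d)) \<in> carrier (cycle_group D)"
    unfolding cycle_group_iff
  proof (intro conjI allI impI ballI)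
    fix v assume v: "v \<in> darts D"
    \<comment> \<open>At each corner \<open>e\<close> of the region the boundary walk leaves the crossing along \<open>e\<close> and enters
      it along \<open>rot D e\<close>.\<close>
    have "(\<Sum>e\<in>orbit (rot D) v. (of_bool (e \<in> region D d) :: int))
        = (\<Sum>e\<in>orbit (rot D) v. of_bool (flip D (rot D e) \<in> region D d))"
      by (simp only: flip_rot_iff)
    also have "\<dots> = (\<Sum>e\<in>rot D ` orbit (rot D) v. of_bool (flip D e \<in> region D d))"
      by (subst sum.reindex) (simp_all add: permutes_inj_on[OF rot_permutes])
    finally show "(\<Sum>e\<in>orbit (rot D) v. (of_bool (e \<in> region D d) :: int))
        = (\<Sum>e\<in>orbit (rot D) v. of_bool (flip D e \<in> region D d))"
      by (simp only: rot_image_crossing[OF v])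
  qed (rule zero)
  show "(\<lambda>e. of_bool (e \<in> region D d)) \<in> boundaries D"
    unfolding boundaries_def mem_Collect_eq
  proof (intro conjI allI impI)
    show "\<exists>m n. \<forall>e\<in>darts D. (of_bool (e \<in> region D d) :: int) = m (region D e) + n {e, flip D e}"
      by (rule exI[of _ "\<lambda>R. of_bool (R = region D d)"], rule exI[of _ "\<lambda>_. 0"], rule ballI)
        (simp only: region_eq_iff add_0_right)
  qed (rule zero)
qed

lemma boundaries_add_diff:
  assumes "k \<in> boundaries D" "l \<in> boundaries D"
  shows "(\<lambda>d. k d + l d) \<in> boundaries D" and "(\<lambda>d. k d - l d) \<in> boundaries D"
proof -
  from assms(1) have k0: "\<forall>d. d \<notin> darts D \<longrightarrow> k d = 0"
    and "\<exists>m n. \<forall>d\<in>darts D. k d = m (region D d) + n {d, flip D d}"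
    unfolding boundaries_def by simp_all
  then obtain m n where k: "\<forall>d\<in>darts D. k d = m (region D d) + n {d, flip D d}" by (elim exE)
  from assms(2) have l0: "\<forall>d. d \<notin> darts D \<longrightarrow> l d = 0"
    and "\<exists>m n. \<forall>d\<in>darts D. l d = m (region D d) + n {d, flip D d}"
    unfolding boundaries_def by simp_all
  then obtain m' n' where l: "\<forall>d\<in>darts D. l d = m' (region D d) + n' {d, flip D d}" by (elim exE)
  show "(\<lambda>d. k d + l d) \<in> boundaries D"
    unfolding boundaries_def mem_Collect_eq
    by (intro conjI exI[of _ "\<lambda>R. m R + m' R"] exI[of _ "\<lambda>E. n E + n' E"])
      (simp_all add: k0 l0 k l)
  show "(\<lambda>d. k d - l d) \<in> boundaries D"
    unfolding boundaries_def mem_Collect_eq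
    by (intro conjI exI[of _ "\<lambda>R. m R - m' R"] exI[of _ "\<lambda>E. n E - n' E"])
      (simp_all add: k0 l0 k l)
qed

lemma coset_boundary:
  assumes "k \<in> boundaries D"
  shows "boundaries D #>\<^bsub>cycle_group D\<^esub> k = boundaries D"
proof -
  have "boundaries D #>\<^bsub>cycle_group D\<^esub> k = (\<lambda>b d. b d + k d) ` boundaries D"
    by (auto simp: r_coset_def cycle_group_def)
  also have "\<dots> = boundaries D"
  proof (intro equalityI subsetI)
    fix b assume "b \<in> (\<lambda>b d. b d + k d) ` boundaries D"
    then show "b \<in> boundaries D" using boundaries_add_diff(1)[OF _ assms] by auto
  next
    fix b assume "b \<in> boundaries D"
    then have "(\<lambda>d. b d - k d) \<in> boundaries D" using assms by (rule boundaries_add_diff(2))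
    then have "(\<lambda>b d. b d + k d) (\<lambda>d. b d - k d) \<in> (\<lambda>b d. b d + k d) ` boundaries D"
      by (rule imageI)
    then show "b \<in> (\<lambda>b d. b d + k d) ` boundaries D" by simp
  qed
  finally show ?thesis .
qed

lemma zero_boundary: "(\<lambda>_. 0) \<in> boundaries D" and zero_cycle: "(\<lambda>_. 0) \<in> carrier (cycle_group D)"
  unfolding boundaries_def cycle_group_def partial_object.simps mem_Collect_eq
  by (intro conjI exI[of _ "\<lambda>_. 0"]; simp)+

end

locale voltage_diagram = torus_diagram D for D :: "'d link_diagram" +
  fixes \<mu> :: "('d \<Rightarrow> int) set \<Rightarrow> int \<times> int" and c :: "'d \<Rightarrow> int \<times> int"
  assumes marking: "homology_marking D \<mu>" and voltage: "voltage D \<mu> c"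
begin

definition total :: "('d \<Rightarrow> int) \<Rightarrow> int \<times> int" where
  "total k = ((\<Sum>d\<in>darts D. k d * fst (c d)), (\<Sum>d\<in>darts D. k d * snd (c d)))"

lemma marking_coset:
  "k \<in> carrier (cycle_group D) \<Longrightarrow> \<mu> (boundaries D #>\<^bsub>cycle_group D\<^esub> k) = total k"
  using voltage unfolding voltage_def total_def by (rule bspec)

lemma total_boundary:
  assumes "k \<in> carrier (cycle_group D)" "k \<in> boundaries D" shows "total k = 0"
proof -
  have "total k = total (\<lambda>_. 0)"
    using marking_coset[OF assms(1)] marking_coset[OF zero_cycle]
    by (simp only: coset_boundary[OF assms(2)] coset_boundary[OF zero_boundary])
  then show ?thesis by (simp add: total_def zero_prod_def)
qed

lemma total_indicator:
  assumes "A \<subseteq> darts D" shows "total (\<lambda>d. of_bool (d \<in> A)) = (\<Sum>d\<in>A. c d)"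
proof -
  have "(\<Sum>d\<in>darts D. of_bool (d \<in> A) * g d) = (\<Sum>d\<in>A. g d)" for g :: "'d \<Rightarrow> int"
    by (rule sum.mono_neutral_cong_right[OF finite_darts assms]) auto
  then show ?thesis by (simp add: total_def prod_eq_iff fst_sum snd_sum)
qed

lemma voltage_flip: assumes d: "d \<in> darts D" shows "c (flip D d) = - c d"
proof -
  have "(\<Sum>e\<in>{d, flip D d}. c e) = total (\<lambda>e. of_bool (e \<in> {d, flip D d}))"
    by (rule total_indicator[symmetric]) (use d in simp)
  also have "\<dots> = 0" by (rule total_boundary[OF edge_cycle[OF d]])
  finally have "c d + c (flip D d) = 0" using flip_neq[OF d] by simp
  then show ?thesis by (rule minus_unique[symmetric])
qed

lemma voltage_region: "d \<in> darts D \<Longrightarrow> (\<Sum>e\<in>region D d. c e) = 0"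
  using total_indicator[OF region_subset_darts] total_boundary[OF region_cycle] by simp

lemma total_surj: "\<exists>k\<in>carrier (cycle_group D). total k = h"
proof -
  have "\<mu> ` carrier (homology1 D) = carrier (integer_group \<times>\<times> integer_group)"
    using marking by (simp add: homology_marking_def iso_def bij_betw_def)
  then have "h \<in> \<mu> ` carrier (homology1 D)" by (simp add: DirProd_def)
  then obtain X where X: "X \<in> carrier (homology1 D)" "h = \<mu> X" by (elim imageE)
  from X(1) obtain k where k: "k \<in> carrier (cycle_group D)" "X = boundaries D #>\<^bsub>cycle_group D\<^esub> k"
    unfolding homology1_def FactGroup_def RCOSETS_def by auto
  have "total k = h" using marking_coset[OF k(1)] k(2) X(2) by simp
  with k(1) show ?thesis by blast
qed

text \<open>
  Walking from the corner \<open>d\<close> to the next corner of its region follows the edge of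
  \<open>rot D d\<close>, whose voltage is the negative of that of \<open>next_corner d\<close>. So
  a walk in the cover starting on sheet \<open>g\<close> at \<open>d\<close> stays on the sheets
  where the sum of the sheet and the potential is \<open>g + s d\<close>.
\<close>

definition corner_potential :: "('d \<Rightarrow> int \<times> int) \<Rightarrow> bool" where
  "corner_potential s \<longleftrightarrow> (\<forall>d\<in>darts D. s (next_corner d) = s d + c (next_corner d))"

lemma corner_potential_exists: "\<exists>s. corner_potential s"
  unfolding corner_potential_def
  by (rule cyclic_potential[OF permutation_of_darts[OF next_corner_permutes]])
    (simp add: voltage_region flip: region_eq_orbit)

text \<open>
  Regions lift homeomorphically to the cover, since the voltages around a region add up to zero;
  the potential names the sheet on which a given corner of a lift is found.
\<close>

lemma region_abelian_cover:
  assumes s: "corner_potential s" and d: "d \<in> darts D"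
  shows "region (abelian_cover D c) (d, g) = (\<lambda>e. (e, g + s d - s e)) ` region D d"
proof -
  let ?F = "\<lambda>x. flip (abelian_cover D c) (rot (abelian_cover D c) x)"
  have step: "?F (e, g + s d - s e) = (next_corner e, g + s d - s (next_corner e))"
    if "e \<in> darts D" for e
  proof -
    have "c (rot D e) = - c (next_corner e)"
      using voltage_flip[of "rot D e"] that by (simp add: next_corner_def)
    moreover have "s (next_corner e) = s e + c (next_corner e)"
      using s that by (simp add: corner_potential_def)
    ultimately show ?thesis by (simp add: abelian_cover_def next_corner_def)
  qed
  have orbit_darts: "e \<in> darts D" if "e \<in> orbit next_corner d" for e
    using permutes_orbit_subset[OF next_corner_permutes d] that by blast
  have base: "?F (d, g) = (next_corner d, g + s d - s (next_corner d))"
    using step[OF d] by simp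
  show ?thesis
    unfolding region_def[of "abelian_cover D c"] region_eq_orbit
  proof (intro equalityI subsetI)
    fix x assume "x \<in> orbit ?F (d, g)"
    then show "x \<in> (\<lambda>e. (e, g + s d - s e)) ` orbit next_corner d"
    proof induction
      case base
      show ?case unfolding \<open>?F (d, g) = _\<close> by (rule imageI[OF orbit.base])
    next
      case (step y)
      then obtain e where e: "e \<in> orbit next_corner d" "y = (e, g + s d - s e)" by (elim imageE)
      show ?case unfolding e(2) \<open>\<And>e. e \<in> darts D \<Longrightarrow> _\<close>[OF orbit_darts[OF e(1)]]
        by (rule imageI[OF orbit.step[OF e(1)]])
    qed
  next
    have "(e, g + s d - s e) \<in> orbit ?F (d, g)" if "e \<in> orbit next_corner d" for e
      using that
    proof induction
      case base
      show ?case unfolding \<open>?F (d, g) = _\<close>[symmetric] by (rule orbit.base)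
    next
      case (step e)
      show ?case unfolding \<open>\<And>e. e \<in> darts D \<Longrightarrow> _\<close>[OF orbit_darts[OF step.hyps], symmetric]
        by (rule orbit.step[OF step.IH])
    qed
    then show "x \<in> orbit ?F (d, g)" if "x \<in> (\<lambda>e. (e, g + s d - s e)) ` orbit next_corner d" for x
      using that by blast
  qed
qed

text \<open>
  The chosen lift of the region at the corner \<open>d\<close> has this corner on the sheet
  \<open>- a d\<close>. Equivalently the corner \<open>d\<close> on sheet zero belongs to the
  translate of that lift under \<open>a d\<close>.
\<close>

definition sheet_function :: "'d set set \<Rightarrow> ('d \<times> (int \<times> int)) set list \<Rightarrow> ('d \<Rightarrow> int \<times> int) \<Rightarrow> bool"
  where
  "sheet_function Sh vs a \<longleftrightarrow>
     (\<forall>d\<in>darts D. region D d \<in> Sh \<longrightarrow> a (next_corner d) = a d + c (next_corner d)) \<and>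
     (\<forall>i<length vs. \<forall>d\<in>darts D. \<forall>g h.
        region (abelian_cover D c) (d, g) = deck h ` (vs ! i) \<longleftrightarrow>
        region D d = fst ` (vs ! i) \<and> g + a d = h)"

lemma sheet_function_exists:
  assumes vs: "lifted_vertices D c Sh vs"
  shows "\<exists>a. sheet_function Sh vs a"
proof -
  obtain s where s: "corner_potential s" using corner_potential_exists by (elim exE)
  have lift: "\<exists>d g. d \<in> darts D \<and> vs ! i = region (abelian_cover D c) (d, g)" if "i < length vs" for i
  proof -
    have "vs ! i \<in> regions (abelian_cover D c)"
      using vs nth_mem[OF that]
      by (auto simp: lifted_vertices_def tait_graph_def lifted_shading_def)
    then show ?thesis by (auto simp: regions_def abelian_cover_def)
  qed
  have "\<forall>i. \<exists>\<gamma>. i < length vs \<longrightarrow> vs ! i = (\<lambda>e. (e, \<gamma> - s e)) ` (fst ` (vs ! i))"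
  proof (intro allI)
    fix i
    show "\<exists>\<gamma>. i < length vs \<longrightarrow> vs ! i = (\<lambda>e. (e, \<gamma> - s e)) ` (fst ` (vs ! i))"
    proof (cases "i < length vs")
      case True
      from lift[OF True] obtain d g where d: "d \<in> darts D"
        and "vs ! i = region (abelian_cover D c) (d, g)" by (elim exE conjE)
      then have eq: "vs ! i = (\<lambda>e. (e, g + s d - s e)) ` region D d"
        by (simp only: region_abelian_cover[OF s d])
      have "fst ` (vs ! i) = region D d" unfolding eq by (simp add: image_image)
      with eq show ?thesis by (intro exI[of _ "g + s d"]) simp
    qed simp
  qed
  from choice[OF this] obtain \<gamma>
    where \<gamma>: "\<forall>i. i < length vs \<longrightarrow> vs ! i = (\<lambda>e. (e, \<gamma> i - s e)) ` (fst ` (vs ! i))" ..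
  have inj: "i = j" if "fst ` (vs ! i) = fst ` (vs ! j)" "i < length vs" "j < length vs" for i j
    using vs that nth_eq_iff_index_eq[of "map (image fst) vs" i j]
    by (simp add: lifted_vertices_def)
  \<comment> \<open>A corner potential is determined up to a constant on every region; subtracting \<open>\<gamma>\<close> adjusts
    the constants to the chosen lifts.\<close>
  define a where "a d = s d - \<gamma> (THE i. i < length vs \<and> fst ` (vs ! i) = region D d)" for d
  have a: "a d = s d - \<gamma> i" if "i < length vs" "region D d = fst ` (vs ! i)" for i d
  proof -
    have "(THE j. j < length vs \<and> fst ` (vs ! j) = region D d) = i"
      by (rule the_equality) (use that inj in auto)
    then show ?thesis by (simp add: a_def)
  qed
  have potential: "a (next_corner d) = a d + c (next_corner d)" if "d \<in> darts D" for d
    using s that by (simp add: a_def corner_potential_def)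
  have lifts: "region (abelian_cover D c) (d, g) = deck h ` (vs ! i) \<longleftrightarrow>
      region D d = fst ` (vs ! i) \<and> g + a d = h" if "i < length vs" "d \<in> darts D" for i d g h
  proof -
    let ?R = "fst ` (vs ! i)"
    have "deck h ` (vs ! i) = (\<lambda>e. (e, h + (\<gamma> i - s e))) ` ?R"
      by (subst \<gamma>[rule_format, OF that(1)]) (simp add: deck_def image_image)
    then have "region (abelian_cover D c) (d, g) = deck h ` (vs ! i) \<longleftrightarrow>
        (\<lambda>e. (e, g + s d - s e)) ` region D d = (\<lambda>e. (e, h + (\<gamma> i - s e))) ` ?R"
      by (simp only: region_abelian_cover[OF s that(2)])
    also have "\<dots> \<longleftrightarrow> region D d = ?R \<and> g + s d = h + \<gamma> i"
    proof (intro iffI conjI)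
      assume eq: "(\<lambda>e. (e, g + s d - s e)) ` region D d = (\<lambda>e. (e, h + (\<gamma> i - s e))) ` ?R"
      from arg_cong[OF this, of "image fst"] show "region D d = ?R"
        unfolding image_image fst_conv image_ident .
      have "(d, g + s d - s d) \<in> (\<lambda>e. (e, h + (\<gamma> i - s e))) ` ?R"
        unfolding eq[symmetric] by (rule imageI[OF self_in_region])
      then have "g + s d - s d = h + (\<gamma> i - s d)" by blast
      then show "g + s d = h + \<gamma> i" by (simp add: algebra_simps)
    next
      assume "region D d = ?R \<and> g + s d = h + \<gamma> i"
      then show "(\<lambda>e. (e, g + s d - s e)) ` region D d = (\<lambda>e. (e, h + (\<gamma> i - s e))) ` ?R"
        by (simp add: add_diff_eq)
    qed
    also have "\<dots> \<longleftrightarrow> region D d = ?R \<and> g + a d = h"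
    proof (rule conj_cong[OF refl])
      assume "region D d = ?R"
      then show "g + s d = h + \<gamma> i \<longleftrightarrow> g + a d = h"
        by (simp only: a[OF that(1)] add_diff_eq diff_eq_eq)
    qed
    finally show ?thesis .
  qed
  show ?thesis
    unfolding sheet_function_def
    by (intro exI[of _ a] conjI ballI allI impI) (erule potential, erule (1) lifts)
qed

end


section \<open>The incidence matrix of a Tait graph\<close>

locale lifted_diagram = voltage_diagram D \<mu> c + shaded_diagram D Sh
  for D :: "'d link_diagram" and \<mu> c and Sh :: "'d set set" +
  fixes vs :: "('d \<times> (int \<times> int)) set list" and a :: "'d \<Rightarrow> int \<times> int" and es :: "'d list"
  assumes vs: "lifted_vertices D c Sh vs"
    and a: "sheet_function Sh vs a"
    and es: "crossing_darts es"
begin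

abbreviation opposite :: "'d \<Rightarrow> 'd" where
  "opposite d \<equiv> rot D (rot D d)"

abbreviation vertex :: "nat \<Rightarrow> 'd set" where
  "vertex i \<equiv> fst ` (vs ! i)"

text \<open>
  The shaded region at the corner \<open>d\<close> as an element of the free module on the vertices
  of the Tait graph, acted upon by the inverses of deck transformations: the exponent is the sheet
  on which the chosen lift of the region has this corner.
\<close>

definition corner :: "nat \<Rightarrow> 'd \<Rightarrow> laurent" where
  "corner i d = (if region D d = vertex i then monomial (- a d) else 0)"

text \<open>
  The conjugate boundary matrix of the preimage of the Tait graph: a column is the difference of the
  two ends of an edge, both seen from the same sheet of the crossing.
\<close>

definition incidence :: "nat \<Rightarrow> nat \<Rightarrow> laurent" where
  "incidence i k = corner i (es ! k) - corner i (opposite (es ! k))"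

definition over_sign :: "'d \<Rightarrow> laurent" where
  "over_sign d = (if over D d then 1 else - 1)"

lemma sheet_step: "d \<in> shaded \<Longrightarrow> a (next_corner d) = a d + c (next_corner d)"
  using a unfolding sheet_function_def shaded_def by blast

lemma cover_region_iff:
  "i < length vs \<Longrightarrow> d \<in> darts D \<Longrightarrow> region (abelian_cover D c) (d, g) = deck h ` (vs ! i) \<longleftrightarrow>
     region D d = vertex i \<and> g + a d = h"
  using a unfolding sheet_function_def by blast

lemma vertex_bij: "bij_betw vertex {..<length vs} Sh"
proof -
  have "bij_betw (\<lambda>i. map (image fst) vs ! i) {..<length vs} (set (map (image fst) vs))"
    by (rule bij_betw_nth) (use vs in \<open>simp_all add: lifted_vertices_def\<close>)
  also have "set (map (image fst) vs) = Sh"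
    using vs by (simp add: lifted_vertices_def tait_graph_def)
  finally show ?thesis
    by (rule bij_betw_cong[THEN iffD1, rotated]) simp
qed

lemma vertex_eq_iff: "i < length vs \<Longrightarrow> j < length vs \<Longrightarrow> vertex i = vertex j \<longleftrightarrow> i = j"
  using vertex_bij by (auto simp: bij_betw_def inj_on_def)

lemma vertex_in: "i < length vs \<Longrightarrow> vertex i \<in> Sh"
  using bij_betw_apply[OF vertex_bij] by blast

lemma length_vs: "length vs = card Sh"
  using bij_betw_same_card[OF vertex_bij] by simp

lemma vertex_dart:
  assumes "i < length vs" shows "\<exists>d\<in>shaded. region D d = vertex i"
proof -
  have "vertex i \<in> regions D"
    using vertex_in[OF assms] shading unfolding checkerboard_shading_def by blast
  then obtain d where "d \<in> darts D" "vertex i = region D d" unfolding regions_def by (elim imageE)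
  then show ?thesis using vertex_in[OF assms] by (auto simp: shaded_def)
qed

lemma es_shaded: "k < length es \<Longrightarrow> es ! k \<in> shaded"
  using es nth_mem[of k es] unfolding crossing_darts_def by blast

lemma es_darts: "k < length es \<Longrightarrow> es ! k \<in> darts D"
  using es_shaded shaded_subset by blast

lemma conj_corner: "laurent_conj (corner i d) = (if region D d = vertex i then monomial (a d) else 0)"
  by (simp add: corner_def laurent_conj_def reindex_zero)

lemma conj_incidence:
  "laurent_conj (incidence i k)
    = laurent_conj (corner i (es ! k)) - laurent_conj (corner i (opposite (es ! k)))"
  by (simp add: incidence_def laurent_conj_def reindex_diff)

lemma over_sign_monomial: "Poly_Mapping.single h (if over D d then 1 else - 1) = over_sign d * monomial h"
  by (simp add: over_sign_def single_uminus)

lemma degree_entry_eq: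
  "degree_entry D Sh vs i = (\<Sum>d\<in>shaded. if region D d = vertex i then over_sign d else 0)"
proof -
  have "degree_entry D Sh vs i = (\<Sum>d\<in>{d \<in> shaded. region D d = vertex i}. over_sign d)"
    by (simp add: degree_entry_def tait_graph_def shaded_def over_sign_def Let_def if_distrib[of of_int] cong: if_cong)
  also have "\<dots> = (\<Sum>d\<in>shaded. if region D d = vertex i then over_sign d else 0)"
    by (rule sum.inter_filter[OF finite_shaded])
  finally show ?thesis .
qed

text \<open>
  An arc of the preimage starting at the lift \<open>vs ! i\<close> is determined by its dart
  \<open>d\<close> in the diagram: it lies on the sheet \<open>- a d\<close>, and its end is the
  translate of a chosen lift under the difference of the sheet functions of the two opposite
  corners.
\<close>

lemma adjacency_entry_eq:
  assumes i: "i < length vs" and j: "j < length vs"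
  shows "adjacency_entry D c Sh vs i j = (\<Sum>d\<in>shaded.
    if region D d = vertex i \<and> region D (opposite d) = vertex j
    then over_sign d * monomial (a (opposite d) - a d) else 0)"
proof -
  let ?T = "{d \<in> shaded. region D d = vertex i \<and> region D (opposite d) = vertex j}"
  let ?\<psi> = "\<lambda>d. ((d, - a d), a (opposite d) - a d)"
  let ?C = "abelian_cover D c"
  have deck0: "deck 0 ` X = X" for X :: "('d \<times> (int \<times> int)) set"
    by (force simp: deck_def)
  have tail: "region ?C (d, g) = vs ! i \<longleftrightarrow> region D d = vertex i \<and> g = - a d"
    if "d \<in> darts D" for d g
    using cover_region_iff[OF i that, of g 0] unfolding deck0 by (simp only: eq_neg_iff_add_eq_0)
  have vsi: "vs ! i \<in> lifted_shading D c Sh"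
    using vs nth_mem[OF i] unfolding lifted_vertices_def tait_graph_def by auto
  have iff: "d \<in> darts D \<and> region ?C (d, g) \<in> lifted_shading D c Sh \<and> region ?C (d, g) = vs ! i \<and>
      region ?C (opposite d, g) = deck h ` (vs ! j)
    \<longleftrightarrow> d \<in> ?T \<and> g = - a d \<and> h = a (opposite d) - a d" for d g h
  proof (cases "d \<in> darts D")
    case True
    then have opp: "opposite d \<in> darts D" by simp
    have "d \<in> shaded" if "region D d = vertex i"
      using True that vertex_in[OF i] by (simp add: shaded_def)
    then show ?thesis
      using True tail[OF True, of g] cover_region_iff[OF j opp, of g h] vsi by auto
  qed (use shaded_subset in auto)
  have "{(e, h). e \<in> darts ?C \<and> region ?C e \<in> lifted_shading D c Sh \<and> region ?C e = vs ! i \<and>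
      region ?C (rot ?C (rot ?C e)) = deck h ` (vs ! j)} = ?\<psi> ` ?T" (is "?S = _")
  proof (rule Set.set_eqI)
    fix x :: "('d \<times> (int \<times> int)) \<times> (int \<times> int)"
    obtain d g h where x: "x = ((d, g), h)" by (metis surj_pair)
    have "x \<in> ?S \<longleftrightarrow> d \<in> darts D \<and> region ?C (d, g) \<in> lifted_shading D c Sh \<and>
        region ?C (d, g) = vs ! i \<and> region ?C (opposite d, g) = deck h ` (vs ! j)"
      by (simp add: x abelian_cover_def)
    also have "\<dots> \<longleftrightarrow> x \<in> ?\<psi> ` ?T" unfolding iff x by blast
    finally show "x \<in> ?S \<longleftrightarrow> x \<in> ?\<psi> ` ?T" .
  qed
  then have "adjacency_entry D c Sh vs i j
      = (\<Sum>(e, h)\<in>?\<psi> ` ?T. Poly_Mapping.single h (if over ?C e then 1 else - 1))"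
    by (simp add: adjacency_entry_def tait_graph_def Let_def conj_assoc)
  also have "\<dots> = (\<Sum>d\<in>?T. over_sign d * monomial (a (opposite d) - a d))"
    by (subst sum.reindex) (auto simp: inj_on_def abelian_cover_def over_sign_monomial)
  also have "\<dots> = (\<Sum>d\<in>shaded. if region D d = vertex i \<and> region D (opposite d) = vertex j
      then over_sign d * monomial (a (opposite d) - a d) else 0)"
    by (rule sum.inter_filter[OF finite_shaded])
  finally show ?thesis .
qed

text \<open>
  The usual factorization of a weighted graph Laplacian. A crossing contributes a rank one matrix
  having four terms; two of them make up the degrees and two the adjacencies, one for each
  direction of travel along the edge. Both directions carry the same weight because opposite darts
  belong to the same strand.
\<close>

lemma laplacian_eq_gram:
  "laplacian_matrix D c Sh vs
    = gram (length es) (length vs) (\<lambda>i k. incidence i k * over_sign (es ! k)) (\<lambda>i k. laurent_conj (incidence i k))"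
proof (rule eq_matI)
  fix i j
  assume "i < dim_row (gram (length es) (length vs) (\<lambda>i k. incidence i k * over_sign (es ! k)) (\<lambda>i k. laurent_conj (incidence i k)))"
    and "j < dim_col (gram (length es) (length vs) (\<lambda>i k. incidence i k * over_sign (es ! k)) (\<lambda>i k. laurent_conj (incidence i k)))"
  then have i: "i < length vs" and j: "j < length vs" by (simp_all add: gram_def)
  let ?g = "\<lambda>d. over_sign d * (corner i d * laurent_conj (corner j d))
    - over_sign d * (corner i d * laurent_conj (corner j (opposite d)))"
  have summand: "incidence i k * over_sign (es ! k) * laurent_conj (incidence j k)
      = ?g (es ! k) + ?g (opposite (es ! k))" if "k < length es" for k
  proof -
    have d: "es ! k \<in> darts D" by (rule es_darts[OF that])
    have "over_sign (opposite (es ! k)) = over_sign (es ! k)" using d by (simp add: over_sign_def)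
    then show ?thesis
      unfolding conj_incidence unfolding incidence_def rot4[OF d] by (simp add: algebra_simps)
  qed
  have diag: "over_sign d * (corner i d * laurent_conj (corner j d))
      = (if i = j then (if region D d = vertex i then over_sign d else 0) else 0)" for d
    using vertex_eq_iff[OF i j] unfolding conj_corner unfolding corner_def
    by (cases "i = j") (auto simp: monomial_mult)
  have off: "over_sign d * (corner i d * laurent_conj (corner j (opposite d)))
      = (if region D d = vertex i \<and> region D (opposite d) = vertex j
         then over_sign d * monomial (a (opposite d) - a d) else 0)" for d
    unfolding conj_corner unfolding corner_def by (simp add: monomial_mult)
  have "(\<Sum>k<length es. incidence i k * over_sign (es ! k) * laurent_conj (incidence j k))
      = (\<Sum>k<length es. ?g (es ! k) + ?g (opposite (es ! k)))"
    by (rule sum.cong[OF refl]) (rule summand, simp)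
  also have "\<dots> = (\<Sum>d\<in>shaded. ?g d)" by (rule sum_crossing_darts[OF es])
  also have "\<dots> = (if i = j then degree_entry D Sh vs i else 0) - adjacency_entry D c Sh vs i j"
    unfolding sum_subtractf diag off degree_entry_eq adjacency_entry_eq[OF i j] by simp
  finally show "laplacian_matrix D c Sh vs $$ (i, j) = gram (length es) (length vs)
      (\<lambda>i k. incidence i k * over_sign (es ! k)) (\<lambda>i k. laurent_conj (incidence i k)) $$ (i, j)"
    using i j by (simp add: laplacian_matrix_def gram_def)
qed (simp_all add: laplacian_matrix_def gram_def)

lemma next_corner_bij_shaded: "bij_betw next_corner shaded shaded"
proof -
  have inj: "inj_on next_corner shaded" by (rule permutes_inj_on[OF next_corner_permutes])
  have "next_corner ` shaded \<subseteq> shaded" by auto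
  then show ?thesis using endo_inj_surj[OF finite_shaded _ inj] inj by (simp add: bij_betw_def)
qed

text \<open>
  A crossing contributes one term for each pair of adjacent corners, that is, for each of its four
  darts, and the sign of the term depends on which of the two corners is shaded. The two ends of an
  edge of the universe have the same two regions as neighbours, but in opposite order, so that by
  the hypothesis their terms cancel. In the application \<open>v\<close> is the conjugate of a
  coordinate of the corners of the unshaded regions.
\<close>

lemma incidence_orthogonal:
  assumes v: "\<And>d. d \<in> shaded \<Longrightarrow>
      corner i (next_corner d) * v (rot D (opposite (next_corner d))) = corner i d * v (rot D d)"
  shows "(\<Sum>k<length es. incidence i k * (v (rot D (es ! k)) - v (rot D (opposite (es ! k))))) = 0"
proof -
  let ?g = "\<lambda>d. corner i d * v (rot D d) - corner i d * v (rot D (opposite d))"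
  have "(\<Sum>k<length es. incidence i k * (v (rot D (es ! k)) - v (rot D (opposite (es ! k)))))
      = (\<Sum>k<length es. ?g (es ! k) + ?g (opposite (es ! k)))"
  proof (rule sum.cong[OF refl])
    fix k assume "k \<in> {..<length es}"
    then have "opposite (opposite (es ! k)) = es ! k" by (intro rot4 es_darts) simp
    then show "incidence i k * (v (rot D (es ! k)) - v (rot D (opposite (es ! k))))
        = ?g (es ! k) + ?g (opposite (es ! k))"
      by (simp add: incidence_def algebra_simps)
  qed
  also have "\<dots> = (\<Sum>d\<in>shaded. corner i d * v (rot D d)) - (\<Sum>d\<in>shaded. corner i d * v (rot D (opposite d)))"
    unfolding sum_subtractf[symmetric] by (rule sum_crossing_darts[OF es, of ?g])
  also have "(\<Sum>d\<in>shaded. corner i d * v (rot D (opposite d)))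
      = (\<Sum>d\<in>shaded. corner i (next_corner d) * v (rot D (opposite (next_corner d))))"
    by (rule sum.reindex_bij_betw[OF next_corner_bij_shaded, symmetric])
  also have "\<dots> = (\<Sum>d\<in>shaded. corner i d * v (rot D d))"
    by (rule sum.cong[OF refl]) (rule v)
  finally show ?thesis by simp
qed

text \<open>
  Membership in the column span of the boundary matrix, that is, vanishing in the homology group
  of degree zero of the preimage of the Tait graph.
\<close>

definition null_homologous :: "(nat \<Rightarrow> laurent) \<Rightarrow> bool" where
  "null_homologous u \<longleftrightarrow> (\<exists>X. \<forall>i<length vs. u i = (\<Sum>k<length es. incidence i k * X k))"

lemma null_homologous_cong:
  assumes "null_homologous u" "\<And>i. i < length vs \<Longrightarrow> u i = u' i" shows "null_homologous u'"
proof -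
  obtain X where X: "\<forall>i<length vs. u i = (\<Sum>k<length es. incidence i k * X k)"
    using assms(1) unfolding null_homologous_def by (elim exE)
  show ?thesis
    unfolding null_homologous_def by (rule exI[of _ X]) (simp add: X flip: assms(2))
qed

lemma null_homologous_zero: "null_homologous (\<lambda>_. 0)"
  unfolding null_homologous_def by (rule exI[of _ "\<lambda>_. 0"]) simp

lemma null_homologous_add:
  assumes "null_homologous u" "null_homologous u'" shows "null_homologous (\<lambda>i. u i + u' i)"
proof -
  obtain X where X: "\<forall>i<length vs. u i = (\<Sum>k<length es. incidence i k * X k)"
    using assms(1) unfolding null_homologous_def by (elim exE)
  obtain X' where X': "\<forall>i<length vs. u' i = (\<Sum>k<length es. incidence i k * X' k)"
    using assms(2) unfolding null_homologous_def by (elim exE)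
  show ?thesis
    unfolding null_homologous_def
    by (rule exI[of _ "\<lambda>k. X k + X' k"]) (simp add: X X' distrib_left sum.distrib)
qed

lemma null_homologous_scale:
  assumes "null_homologous u" shows "null_homologous (\<lambda>i. r * u i)"
proof -
  obtain X where X: "\<forall>i<length vs. u i = (\<Sum>k<length es. incidence i k * X k)"
    using assms unfolding null_homologous_def by (elim exE)
  show ?thesis
    unfolding null_homologous_def
    by (rule exI[of _ "\<lambda>k. r * X k"]) (simp add: X sum_distrib_left mult.left_commute)
qed

lemma null_homologous_opposite:
  assumes "d \<in> shaded" shows "null_homologous (\<lambda>i. corner i d - corner i (opposite d))"
proof -
  have column: "null_homologous (\<lambda>i. incidence i k)" if "k < length es" for k
    unfolding null_homologous_def
    by (rule exI[of _ "\<lambda>l. if l = k then 1 else 0"]) (simp add: that if_distrib cong: if_cong)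
  have "d \<in> set es \<or> d \<in> opposite ` set es" using es assms unfolding crossing_darts_def by blast
  then obtain k where k: "k < length es" "d = es ! k \<or> d = opposite (es ! k)"
    by (auto simp: in_set_conv_nth)
  from k(2) show ?thesis
  proof
    assume "d = es ! k"
    then show ?thesis using column[OF k(1)] by (simp add: incidence_def)
  next
    assume d: "d = opposite (es ! k)"
    have "opposite d = es ! k" unfolding d by (rule rot4[OF es_darts[OF k(1)]])
    with d show ?thesis
      using null_homologous_scale[OF column[OF k(1)], of "- 1"] by (simp add: incidence_def)
  qed
qed

text \<open>
  Every dart is pushed into a shaded region at its crossing: into the corner on its left or, if
  that one is unshaded, into the next corner counterclockwise. In this way the connectedness of the
  universe is transferred to the Tait graph.
\<close>

definition dart_vector :: "'d \<Rightarrow> nat \<Rightarrow> laurent" where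
  "dart_vector d i = corner i (if d \<in> shaded then d else rot D d)"

text \<open>
  In the cover, the vertices attached to \<open>d\<close> on sheet \<open>0\<close> and to
  \<open>e\<close> on sheet \<open>h\<close> are homologous. For \<open>d = e\<close> such
  \<open>h\<close> form a subgroup, which is shown to be everything.
\<close>

definition related :: "int \<times> int \<Rightarrow> 'd \<Rightarrow> 'd \<Rightarrow> bool" where
  "related h d e \<longleftrightarrow> null_homologous (\<lambda>i. dart_vector e i - monomial h * dart_vector d i)"

lemma related_refl: "related 0 d d"
  unfolding related_def using null_homologous_zero by simp

lemma related_trans:
  assumes "related h d e" "related k e f" shows "related (k + h) d f"
proof -
  have "null_homologous (\<lambda>i. (dart_vector f i - monomial k * dart_vector e i)
      + monomial k * (dart_vector e i - monomial h * dart_vector d i))"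
    by (rule null_homologous_add[OF assms(2)[unfolded related_def] null_homologous_scale[OF assms(1)[unfolded related_def]]])
  then show ?thesis
    unfolding related_def
    by (rule null_homologous_cong) (simp add: right_diff_distrib monomial_mult flip: mult.assoc)
qed

lemma related_sym:
  assumes "related h d e" shows "related (- h) e d"
proof -
  have "null_homologous (\<lambda>i. - monomial (- h) * (dart_vector e i - monomial h * dart_vector d i))"
    by (rule null_homologous_scale[OF assms[unfolded related_def]])
  then show ?thesis
    unfolding related_def
    by (rule null_homologous_cong) (simp add: right_diff_distrib monomial_mult flip: mult.assoc)
qed

lemma related_rot:
  assumes d: "d \<in> darts D" shows "related 0 d (rot D d)"
proof (cases "d \<in> shaded")
  case True
  have "null_homologous (\<lambda>i. - 1 * (corner i d - corner i (opposite d)))"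
    by (rule null_homologous_scale[OF null_homologous_opposite[OF True]])
  then show ?thesis
    unfolding related_def by (rule null_homologous_cong) (use d True in \<open>simp add: dart_vector_def\<close>)
next
  case False
  have "null_homologous (\<lambda>i. dart_vector (rot D d) i - monomial 0 * dart_vector d i)"
    by (rule null_homologous_cong[OF null_homologous_zero]) (use d False in \<open>simp add: dart_vector_def\<close>)
  then show ?thesis unfolding related_def .
qed

text \<open>
  Let \<open>d\<close> be shaded; the other case is the same edge traversed backwards. The dart
  \<open>g\<close> preceding \<open>flip D d\<close> at its crossing has the corner \<open>d\<close>
  as the next corner of its region. So \<open>g\<close> and \<open>d\<close> describe the same
  vertex on sheets differing by the voltage of \<open>d\<close>, and the corner attached to
  \<open>flip D d\<close> is opposite to \<open>g\<close>.
\<close>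

lemma related_flip:
  assumes "d \<in> darts D" shows "related (c d) d (flip D d)"
proof -
  have shaded_case: "related (c d) d (flip D d)" if d: "d \<in> shaded" for d
  proof -
    have dD: "d \<in> darts D" using d shaded_subset by blast
    define g where "g = rot D (opposite (flip D d))"
    have rot_g: "rot D g = flip D d" unfolding g_def using dD by (simp add: rot4)
    have next_g: "next_corner g = d" unfolding next_corner_def rot_g using dD by simp
    have g: "g \<in> shaded" using d next_corner_shaded[of g] unfolding next_g by simp
    have "a d = a g + c d" using sheet_step[OF g] unfolding next_g .
    then have g_d: "corner i g = monomial (c d) * corner i d" for i
      using region_next_corner[of g] unfolding next_g corner_def by (simp add: monomial_mult)
    have "null_homologous (\<lambda>i. - 1 * (corner i g - corner i (opposite g)))"
      by (rule null_homologous_scale[OF null_homologous_opposite[OF g]])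
    then have "null_homologous (\<lambda>i. corner i (opposite g) - monomial (c d) * corner i d)"
      by (rule null_homologous_cong) (simp add: g_d)
    then show ?thesis
      unfolding related_def dart_vector_def rot_g using d dD by simp
  qed
  show ?thesis
  proof (cases "d \<in> shaded")
    case False
    then have "related (c (flip D d)) (flip D d) (flip D (flip D d))"
      using assms by (intro shaded_case) simp
    then have "related (- c d) (flip D d) d" using assms voltage_flip[OF assms] by simp
    from related_sym[OF this] show ?thesis by simp
  qed (rule shaded_case)
qed

lemma related_connected:
  assumes "d \<in> darts D" "e \<in> darts D" shows "\<exists>h. related h d e"
proof -
  have "e \<in> darts D \<and> (\<exists>h. related h d e)"
    using connected[OF assms]
  proof (induction rule: rtrancl_induct)
    case base
    show ?case using assms related_refl by blast
  next
    case (step e f)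
    then obtain h where e: "e \<in> darts D" and h: "related h d e" by blast
    from step.hyps(2) have "f = rot D e \<or> f = flip D e" by simp
    then show ?case
    proof
      assume f: "f = rot D e"
      show ?thesis
        unfolding f using rot_in_darts[of e] e related_trans[OF h related_rot[OF e]] by blast
    next
      assume f: "f = flip D e"
      show ?thesis
        unfolding f using flip_in_darts[of e] e related_trans[OF h related_flip[OF e]] by blast
    qed
  qed
  then show ?thesis ..
qed

definition scaled :: "int \<Rightarrow> int \<times> int \<Rightarrow> int \<times> int" where
  "scaled n h = (n * fst h, n * snd h)"

lemma related_scaled:
  assumes "related h d d" shows "related (scaled n h) d d"
proof (induction n rule: int_induct[where k = 0])
  case base
  show ?case using related_refl by (simp add: scaled_def flip: zero_prod_def)
next
  case (step1 n)
  have "scaled (n + 1) h = scaled n h + h" by (simp add: scaled_def prod_eq_iff algebra_simps)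
  then show ?case using related_trans[OF assms step1.IH] by simp
next
  case (step2 n)
  have "scaled (n - 1) h = scaled n h + - h" by (simp add: scaled_def prod_eq_iff algebra_simps)
  then show ?case using related_trans[OF related_sym[OF assms] step2.IH] by simp
qed

lemma related_sum:
  assumes "finite A" "\<And>x. x \<in> A \<Longrightarrow> related (h x) d d" shows "related (\<Sum>x\<in>A. h x) d d"
  using assms
proof (induction A rule: finite_induct)
  case empty
  show ?case using related_refl by simp
next
  case (insert x A)
  have "related (sum h A) d d" using insert by blast
  from related_trans[OF this insert.prems[OF insertI1]] show ?case using insert.hyps by simp
qed

text \<open>
  The voltages are changed by a gauge transformation \<open>b\<close>, constant on crossings, into
  voltages which all lie in the group of those \<open>h\<close> under which \<open>d0\<close> is
  homologous to its translate. The total value of a cycle is unaffected. This avoids decomposing the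
  cycle into closed walks.
\<close>

lemma related_total:
  assumes d0: "d0 \<in> darts D" and k: "k \<in> carrier (cycle_group D)"
  shows "related (total k) d0 d0"
proof -
  \<comment> \<open>A base dart for every crossing makes the gauge transformation constant on crossings.\<close>
  define rep where "rep d = (SOME e. e \<in> orbit (rot D) d)" for d
  have rep_in: "rep d \<in> orbit (rot D) d" for d
    unfolding rep_def by (rule someI[of _ d]) (rule self_in_crossing)
  have "\<forall>d. \<exists>h. d \<in> darts D \<longrightarrow> related h d0 d" using related_connected[OF d0] by blast
  from choice[OF this] obtain b0 where b0: "\<forall>d. d \<in> darts D \<longrightarrow> related (b0 d) d0 d" ..
  define b where "b d = b0 (rep d)" for d
  have b_crossing: "b e = b d" if "e \<in> orbit (rot D) d" for d e
    unfolding b_def rep_def crossing_eqI[OF that] ..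
  have same_crossing: "related 0 d e" if "d \<in> darts D" "e \<in> orbit (rot D) d" for d e
    using that(2)
  proof induction
    case base
    show ?case by (rule related_rot[OF that(1)])
  next
    case (step e)
    have "e \<in> darts D" using crossing_subset_darts[OF that(1)] step.hyps by blast
    from related_trans[OF step.IH related_rot[OF this]] show ?case by simp
  qed
  have b: "related (b d) d0 d" if d: "d \<in> darts D" for d
  proof -
    have r: "rep d \<in> darts D" using crossing_subset_darts[OF d] rep_in by blast
    have "d \<in> orbit (rot D) (rep d)" using crossing_eqI[OF rep_in] self_in_crossing by simp
    from related_trans[OF b0[rule_format, OF r] same_crossing[OF r this]]
    show ?thesis by (simp add: b_def)
  qed
  have loop: "related (- b (flip D d) + (c d + b d)) d0 d0" if d: "d \<in> darts D" for d
    by (rule related_trans[OF related_trans[OF b[OF d] related_flip[OF d]] related_sym[OF b]])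
      (use d in simp)
  have gauge: "total k = (\<Sum>d\<in>darts D. scaled (k d) (- b (flip D d) + (c d + b d)))"
  proof -
    have zero: "(\<Sum>d\<in>darts D. k d * p (b d)) = (\<Sum>d\<in>darts D. k d * p (b (flip D d)))"
      for p :: "int \<times> int \<Rightarrow> int"
    proof -
      have crossing: "(\<Sum>d\<in>v. k d * p (b d)) = (\<Sum>d\<in>v. k (flip D d) * p (b d))"
        if "v \<in> crossings D" for v
      proof -
        from that obtain d where d: "d \<in> darts D" "v = orbit (rot D) d"
          unfolding crossings_def by (elim imageE)
        have "(\<Sum>e\<in>v. k' e * p (b e)) = (\<Sum>e\<in>v. k' e) * p (b d)" for k'
          unfolding d(2) sum_distrib_right by (rule sum.cong) (simp_all add: b_crossing)
        moreover have "(\<Sum>e\<in>v. k e) = (\<Sum>e\<in>v. k (flip D e))"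
          using k d unfolding cycle_group_iff by blast
        ultimately show ?thesis by simp
      qed
      have split: "(\<Sum>d\<in>darts D. g d) = (\<Sum>v\<in>crossings D. \<Sum>d\<in>v. g d)" for g :: "'d \<Rightarrow> int"
      proof -
        have fin: "\<forall>v\<in>crossings D. finite v"
          using finite_darts crossings_partition(1) by (metis Union_upper finite_subset)
        have disj: "\<forall>v\<in>crossings D. \<forall>v'\<in>crossings D. v \<noteq> v' \<longrightarrow> v \<inter> v' = {}"
          using crossings_partition(3) by blast
        show ?thesis
          using sum.Union_disjoint[OF fin disj, of g] by (simp add: crossings_partition(1))
      qed
      have "(\<Sum>d\<in>darts D. k d * p (b d)) = (\<Sum>d\<in>darts D. k (flip D d) * p (b d))"
        unfolding split by (rule sum.cong[OF refl crossing])
      also have "\<dots> = (\<Sum>d\<in>darts D. k (flip D (flip D d)) * p (b (flip D d)))"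
        by (rule sum_flip[symmetric])
      also have "\<dots> = (\<Sum>d\<in>darts D. k d * p (b (flip D d)))"
        by (rule sum.cong[OF refl]) simp
      finally show ?thesis .
    qed
    show ?thesis
      using zero[of fst] zero[of snd]
      by (simp add: total_def scaled_def prod_eq_iff fst_sum snd_sum distrib_left sum.distrib
          sum_negf right_diff_distrib sum_subtractf)
  qed
  show ?thesis
    unfolding gauge by (rule related_sum[OF finite_darts related_scaled[OF loop]])
qed

lemma related_loop: "d \<in> darts D \<Longrightarrow> related h d d"
  using total_surj[of h] related_total by blast

text \<open>
  A vertex and its translate under \<open>h\<close> are homologous, because every \<open>h\<close>
  is the total value of a cycle; the chains witnessing this are the columns of the right inverse.
\<close>

lemma incidence_right_inverse:
  "\<exists>X. \<forall>i<length vs. \<forall>j<length vs.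
     (\<Sum>k<length es. incidence i k * X j k) = (if i = j then monomial h - 1 else 0)"
proof -
  have "\<exists>X. \<forall>i<length vs. (if i = j then monomial h - 1 else 0) = (\<Sum>k<length es. incidence i k * X k)"
    if j: "j < length vs" for j
  proof -
    obtain d where d: "d \<in> shaded" "region D d = vertex j" using vertex_dart[OF j] by blast
    have "related (- h) d d" by (rule related_loop) (use d(1) shaded_subset in blast)
    \<comment> \<open>With the translation \<open>- h\<close> the factor \<open>monomial (h + a d)\<close> turns the difference into
      \<open>monomial h - 1\<close> times a unit vector.\<close>
    then have "null_homologous (\<lambda>i. monomial (h + a d) * (dart_vector d i - monomial (- h) * dart_vector d i))"
      unfolding related_def by (rule null_homologous_scale)
    then have "null_homologous (\<lambda>i. if i = j then monomial h - 1 else 0)"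
    proof (rule null_homologous_cong)
      fix i assume i: "i < length vs"
      have "dart_vector d i = (if i = j then monomial (- a d) else 0)"
        using d vertex_eq_iff[OF i j] by (auto simp: dart_vector_def corner_def)
      then show "monomial (h + a d) * (dart_vector d i - monomial (- h) * dart_vector d i)
          = (if i = j then monomial h - 1 else 0)"
        by (simp add: right_diff_distrib monomial_mult)
    qed
    then show ?thesis unfolding null_homologous_def .
  qed
  then have "\<forall>j. \<exists>X. j < length vs \<longrightarrow> (\<forall>i<length vs.
      (if i = j then monomial h - 1 else 0) = (\<Sum>k<length es. incidence i k * X k))" by blast
  from choice[OF this] obtain X where "\<forall>j. j < length vs \<longrightarrow> (\<forall>i<length vs.
      (if i = j then monomial h - 1 else 0) = (\<Sum>k<length es. incidence i k * X j k))" ..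
  then show ?thesis by (intro exI[of _ X]) simp
qed

end


section \<open>Dual Tait graphs\<close>

theorem proposition7p1:
  fixes D :: "'d link_diagram"
    and \<mu> :: "('d \<Rightarrow> int) set \<Rightarrow> int \<times> int"
    and c :: "'d \<Rightarrow> int \<times> int"
    and Sh :: "'d set set"
    and vs vs' :: "('d \<times> (int \<times> int)) set list"
    and \<Delta> \<Delta>' :: laurent
  assumes "torus_link_diagram D"
    and "homology_marking D \<mu>"
    and "voltage D \<mu> c"
    and "checkerboard_shading D Sh"
    and "lifted_vertices D c Sh vs"
    and "lifted_vertices D c (regions D - Sh) vs'"
    and "laplacian_polynomial D c Sh vs \<Delta>"
    and "laplacian_polynomial D c (regions D - Sh) vs' \<Delta>'"
  shows "\<exists>u. u dvd 1 \<and> \<Delta>' = u * \<Delta>"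
proof -
  interpret voltage_diagram D \<mu> c
    using assms(1-3) by unfold_locales
  interpret shaded_diagram D Sh
    using assms(4) by unfold_locales
  obtain es where es: "crossing_darts es" using crossing_darts_exist by (elim exE)
  obtain a where a: "sheet_function Sh vs a" using sheet_function_exists[OF assms(5)] by (elim exE)
  obtain a' where a': "sheet_function (regions D - Sh) vs' a'"
    using sheet_function_exists[OF assms(6)] by (elim exE)
  interpret G: lifted_diagram D \<mu> c Sh vs a es
    using assms(5) a es by unfold_locales
  interpret G': lifted_diagram D \<mu> c "regions D - Sh" vs' a' "map (rot D) es"
    using assms(6) a' shaded_diagram.shading[OF complementary] crossing_darts_complementary[OF es]
    by (intro lifted_diagram.intro lifted_diagram_axioms.intro complementary voltage_diagram_axioms)
  let ?p = "length vs" and ?q = "length vs'"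
  have "card Sh \<le> card (regions D)" "card (regions D - Sh) = card (regions D) - card Sh"
    using shading finite_darts unfolding checkerboard_shading_def regions_def
    by (auto intro!: card_mono card_Diff_subset finite_subset[of Sh])
  then have pq: "?p + ?q = length es"
    by (simp add: G.length_vs G'.length_vs length_crossing_darts[OF es] card_regions)
  define w where "w k = G.over_sign (es ! k)" for k
  define P where "P = G.incidence"
  define Q where "Q = G'.incidence"
  \<comment> \<open>Of two successive darts at a crossing exactly one is on the overcrossing strand; this is the
    rule that dual edges have opposite weights.\<close>
  have w': "G'.over_sign (rot D (es ! k)) = - w k" if "k < length es" for k
    using that G.es_darts[OF that] by (simp add: w_def G.over_sign_def G'.over_sign_def)
  have w: "w k * w k = 1" "laurent_conj (w k) = w k" for k
  proof -
    interpret conj: comm_ring_hom laurent_conj by (rule comm_ring_hom_laurent_conj)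
    show "w k * w k = 1" "laurent_conj (w k) = w k"
      by (auto simp: w_def G.over_sign_def conj.hom_uminus)
  qed
  have orth: "(\<Sum>k<?p + ?q. P i k * laurent_conj (Q j k)) = 0" if j: "j < ?q" for i j
  proof -
    have "(\<Sum>k<length es. G.incidence i k * (laurent_conj (G'.corner j (rot D (es ! k)))
        - laurent_conj (G'.corner j (rot D (G.opposite (es ! k)))))) = 0"
    proof (rule G.incidence_orthogonal)
      fix d assume d: "d \<in> shaded"
      then have dD: "d \<in> darts D" using shaded_subset by blast
      \<comment> \<open>The darts \<open>rot D d\<close> and \<open>e\<close> are the two ends of an edge of the universe, and \<open>d\<close> and \<open>b\<close> are the
        corners preceding them at their crossings.\<close>
      define e where "e = next_corner d"
      define b where "b = rot D (G.opposite e)"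
      have eD: "e \<in> darts D" and flip_e: "flip D e = rot D d" 
        using dD by (simp_all add: e_def next_corner_def)
      have bD: "b \<in> darts D" using eD by (simp add: b_def)
      have "rot D b = e" unfolding b_def by (rule rot4[OF eD])
      then have next_b: "next_corner b = rot D d" by (simp add: next_corner_def flip_e)
      have "b \<notin> shaded" using d dD bD next_corner_shaded[of b] unfolding next_b by simp
      then have "b \<in> G'.shaded" using bD by (simp add: shaded_complementary)
      from G'.sheet_step[OF this] have "a' (rot D d) = a' b - c e"
        using voltage_flip[OF eD] unfolding next_b flip_e by simp
      moreover have "a e = a d + c e" using G.sheet_step[OF d] by (simp add: e_def)
      ultimately have exponent: "- a e + a' b = - a d + a' (rot D d)" by simp
      have region: "region D e = region D d" "region D b = region D (rot D d)"
        using region_next_corner[of d] region_next_corner[of b] by (simp_all add: e_def next_b)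
      show "G.corner i (next_corner d) * laurent_conj (G'.corner j (rot D (G.opposite (next_corner d))))
          = G.corner i d * laurent_conj (G'.corner j (rot D d))"
        unfolding e_def[symmetric] b_def[symmetric] G'.conj_corner G.corner_def region
        using exponent by (simp add: monomial_mult)
    qed
    then show ?thesis
      unfolding pq P_def Q_def G'.conj_incidence by simp
  qed
  have y: "monomial (0, 1) - 1 \<noteq> (0 :: laurent)"
    using monomial_eq_one_iff[of "(0, 1)"] by (auto simp: zero_prod_def)
  have inverse_P: "\<exists>X. \<forall>i<?p. \<forall>j<?p. (\<Sum>k<?p + ?q. P i k * X j k) = (if i = j then \<gamma> else 0)"
    and inverse_Q: "\<exists>X. \<forall>i<?q. \<forall>j<?q. (\<Sum>k<?p + ?q. Q i k * X j k) = (if i = j then \<gamma> else 0)"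
    if "\<gamma> \<in> {monomial (0, 1) - 1, monomial (1, 0) - 1}" for \<gamma>
  proof -
    from that obtain h where h: "\<gamma> = monomial h - 1" by blast
    show "\<exists>X. \<forall>i<?p. \<forall>j<?p. (\<Sum>k<?p + ?q. P i k * X j k) = (if i = j then \<gamma> else 0)"
      unfolding h pq P_def by (rule G.incidence_right_inverse)
    show "\<exists>X. \<forall>i<?q. \<forall>j<?q. (\<Sum>k<?p + ?q. Q i k * X j k) = (if i = j then \<gamma> else 0)"
      using G'.incidence_right_inverse[of h] unfolding h pq Q_def by simp
  qed
  let ?L = "laplacian_matrix D c Sh vs" and ?L' = "laplacian_matrix D c (regions D - Sh) vs'"
  have "\<exists>u. u dvd 1 \<and>
      det (gram (?p + ?q) ?q (\<lambda>i k. Q i k * w k) (\<lambda>i k. laurent_conj (Q i k)))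
        = u * det (gram (?p + ?q) ?p (\<lambda>i k. P i k * w k) (\<lambda>i k. laurent_conj (P i k)))"
    by (rule complementary_gram_dets_associated[OF comm_ring_hom_laurent_conj laurent_conj_laurent_conj
          w orth y_minus_1_cancel_x_minus_1 y inverse_P inverse_Q])
  moreover have "?L = gram (?p + ?q) ?p (\<lambda>i k. P i k * w k) (\<lambda>i k. laurent_conj (P i k))"
    unfolding G.laplacian_eq_gram pq P_def w_def ..
  moreover have "?L' = (- 1) \<cdot>\<^sub>m gram (?p + ?q) ?q (\<lambda>i k. Q i k * w k) (\<lambda>i k. laurent_conj (Q i k))"
    unfolding G'.laplacian_eq_gram pq Q_def
    by (rule eq_matI) (simp_all add: gram_def w' flip: sum_negf)
  ultimately obtain u where u: "u dvd 1" "det ?L' = (- 1) ^ ?q * (u * det ?L)"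
    by (auto simp: gram_def)
  obtain t where t: "t dvd 1" "det ?L = t * \<Delta>"
    using module_order_associated[OF laplacian_polynomial_det[unfolded laplacian_polynomial_def]
        assms(7)[unfolded laplacian_polynomial_def]] by blast
  obtain s where s: "s dvd 1" "\<Delta>' = s * det ?L'"
    using module_order_associated[OF assms(8)[unfolded laplacian_polynomial_def]
        laplacian_polynomial_det[unfolded laplacian_polynomial_def]] by blast
  have "(- 1 :: laurent) ^ ?q dvd 1" by (simp add: minus_one_power_iff)
  then have "s * ((- 1) ^ ?q * (u * t)) dvd 1" using s(1) u(1) t(1) by (simp add: is_unit_mult_iff)
  moreover have "\<Delta>' = s * ((- 1) ^ ?q * (u * t)) * \<Delta>"
    unfolding s(2) u(2) t(2) by (simp only: mult.assoc)
  ultimately show ?thesis by blast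
qed

end
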